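(* Let $\mathbb{F}$ be a field with $\mathrm{char}\,\mathbb{F}\neq2$, let $\Phi\subset\{0,1\}$ and $\eta\in\mathbb{F}\setminus\{0,1\}$. (i) A 2-generated $\mathcal{F}_\Phi(\eta)$-axial algebra with $\Phi\neq\{0,1\}$ and $\eta\neq\frac12$, $\eta\neq-1$ is isomorphic to one of the following 10 algebras: $\mathrm{1A}$, $\widehat{\mathrm{1A}}$, $\mathrm{2A}$, $\widehat{\mathrm{2A}}$, $\mathrm{3C}(\eta)$, $\widehat{\mathrm{3C}}(\eta)$, $\mathrm{3C}^{0}(\eta)$, $\mathrm{3C}^{00}(\eta)$, $\widehat{\mathrm{3C}^{0}}(\eta)$, $\widehat{\mathrm{3C}^{00}}(\eta)$. (ii) A 2-generated $\mathcal{F}_\Phi(-1)$-axial algebra with $\Phi\neq\{0,1\}$ is isomorphic to one of the following 16 algebras: the 10 algebras in (i) taken with $\eta=-1$, and $\mathrm{3C}(-1)^\times$, $\widehat{\mathrm{3C}}(-1)^\times$, $\mathrm{3C}^{0}(-1)^\times$, $\mathrm{3C}^{00}(-1)^\times$, $\widehat{\mathrm{3C}^{0}}(-1)^\times$, $\widehat{\mathrm{3C}^{00}}(-1)^\times$.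
   Context: Algebras are commutative, not necessarily associative or unital. For an algebra $M$ over $\mathbb{F}$, $a\in M$ and $s\in\mathbb{F}$ put $M(a,s)=\{x\in M: ax=sx\}$. The fusion rule $\mathcal{F}_\Phi(\eta)$ is the set $\{0,1,\eta\}$ with the symmetric operation $0\star0=\{0\}$, $1\star1=\{1\}$, $0\star1=\Phi$, $0\star\eta=1\star\eta=\{\eta\}$, $\eta\star\eta=\{0,1\}$. An $\mathcal{F}_\Phi(\eta)$-axis of $M$ is an idempotent $a$ with $M=M(a,0)\oplus M(a,1)\oplus M(a,\eta)$ and $M(a,s)M(a,t)\subset\bigoplus_{u\in s\star t}M(a,u)$ for all $s,t\in\{0,1,\eta\}$. An $\mathcal{F}_\Phi(\eta)$-axial algebra is an algebra together with a set of $\mathcal{F}_\Phi(\eta)$-axes generating it as an $\mathbb{F}$-algebra; it is 2-generated if it is generated by two such axes. The algebras, each with its generating axes ($\oplus$ between algebras is direct sum of algebras, with componentwise multiplication): - $\mathrm{1A}=\mathbb{F}a_0$, $a_0a_0=a_0$, regarded formally as generated by $a_0$ and $a_0$. - $\mathrm{2A}=\mathbb{F}s_0\oplus\mathbb{F}s_1$, $s_0s_0=s_0$, $s_1s_1=s_1$, $s_0s_1=0$, generated by $s_0,s_1$. - $\widehat{\mathrm{1A}}=\mathbb{F}a\oplus\mathbb{F}b$ with $aa=a$, $bb=b$, $ab=0$, generated by $a,a+b$. - $\widehat{\mathrm{2A}}=\mathbb{F}a\oplus\mathrm{2A}$ with $aa=a$, generated by $a+s_0,a+s_1$. - $\mathrm{3C}(\eta)$: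 basis $a_{-1},a_0,a_1$, $a_ia_i=a_i$, $a_ia_j=\frac\eta2(a_i+a_j-a_k)$ for $\{i,j,k\}=\{-1,0,1\}$, generated by $a_0,a_1$. - $\widehat{\mathrm{3C}}(\eta)$: basis $\hat q,\hat a_{-1},\hat a_0,\hat a_1$, $\hat qx=(\eta+1)x$ for all $x$, $\hat a_i\hat a_i=\hat a_i$, $\hat a_i\hat a_j=-\frac12\hat q+\frac{\eta+1}2(\hat a_i+\hat a_j)+\frac{1-\eta}2\hat a_k$ for $\{i,j,k\}=\{-1,0,1\}$, generated by $\hat a_0,\hat a_1$. - $\mathrm{3C}^0(\eta)=\mathrm{3C}(\eta)\oplus\mathbb{F}s$ with $ss=s$, generated by $a_0,a_1+s$. - $\mathrm{3C}^{00}(\eta)=\mathrm{3C}(\eta)\oplus\mathrm{2A}$, generated by $a_0+s_0,a_1+s_1$. - $\widehat{\mathrm{3C}^0}(\eta)=\widehat{\mathrm{3C}}(\eta)\oplus\mathbb{F}s$ with $ss=s$, generated by $\hat a_0,\hat a_1+s$. - $\widehat{\mathrm{3C}^{00}}(\eta)=\widehat{\mathrm{3C}}(\eta)\oplus\mathrm{2A}$, generated by $\hat a_0+s_0,\hat a_1+s_1$. For $\eta=-1$: $\mathrm{3C}(-1)^\times$, $\mathrm{3C}^0(-1)^\times$, $\mathrm{3C}^{00}(-1)^\times$ are the quotients of $\mathrm{3C}(-1)$, $\mathrm{3C}^0(-1)$, $\mathrm{3C}^{00}(-1)$ by the ideal $\mathbb{F}(a_0+a_1+a_{-1})$; and $\widehat{\mathrm{3C}}(-1)^\times$,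 $\widehat{\mathrm{3C}^0}(-1)^\times$, $\widehat{\mathrm{3C}^{00}}(-1)^\times$ are the quotients of $\widehat{\mathrm{3C}}(-1)$, $\widehat{\mathrm{3C}^0}(-1)$, $\widehat{\mathrm{3C}^{00}}(-1)$ by the ideal $\mathbb{F}\hat q$.
   Formalization: Part (ii) also assumes η = −1 ≠ 1/2, i.e. char F ≠ 3: in characteristic 3 the 3-dimensional spin factor generated by (1+u)/2, (1+v)/2 is a counterexample. Axes are taken to be nonzero idempotents, since otherwise the zero algebra would be a counterexample. *)

theory Defs
  imports Complex_Main "HOL-Library.Numeral_Type"
begin

section \<open>Axes and 2-generated axial algebras\<close>

locale comm_algebra = vector_space scale
  for scale :: "'f::field \<Rightarrow> 'm::ab_group_add \<Rightarrow> 'm" (infixr \<open>*s\<close> 75) +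
  fixes mult :: "'m \<Rightarrow> 'm \<Rightarrow> 'm" (infixl \<open>\<cdot>\<close> 70)
  assumes mult_commute: "x \<cdot> y = y \<cdot> x"
    and mult_add_left: "(x + y) \<cdot> z = x \<cdot> z + y \<cdot> z"
    and mult_scale_left: "(c *s x) \<cdot> z = c *s (x \<cdot> z)"

definition fusion :: "'f::field set \<Rightarrow> 'f \<Rightarrow> 'f \<Rightarrow> 'f \<Rightarrow> 'f set" where
  "fusion \<Phi> \<eta> s t =
    (if s = 0 \<and> t = 0 then {0}
     else if s = 1 \<and> t = 1 then {1}
     else if s = 0 \<and> t = 1 \<or> s = 1 \<and> t = 0 then \<Phi>
     else if s = \<eta> \<and> t = \<eta> then {0, 1}
     else {\<eta>})"

context comm_algebra
begin

definition eigenspace :: "'m \<Rightarrow> 'f \<Rightarrow> 'm set" where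
  "eigenspace a s = {x. a \<cdot> x = s *s x}"

definition eigenspace_sum :: "'m \<Rightarrow> 'f set \<Rightarrow> 'm set" where
  "eigenspace_sum a S = {\<Sum>u\<in>S. f u |f. \<forall>u\<in>S. f u \<in> eigenspace a u}"

text \<open>
  As usual for axes, idempotents are understood to be nonzero. (The zero vector satisfies all
  the other conditions, and the zero algebra would be generated by it.)
\<close>

definition axis :: "'f set \<Rightarrow> 'f \<Rightarrow> 'm \<Rightarrow> bool" where
  "axis \<Phi> \<eta> a \<longleftrightarrow>
     a \<noteq> 0 \<and> a \<cdot> a = a \<and>
     (\<forall>x. \<exists>!(x0, x1, xe). x0 \<in> eigenspace a 0 \<and> x1 \<in> eigenspace a 1 \<and> xe \<in> eigenspace a \<eta> \<and>
        x = x0 + x1 + xe) \<and>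
     (\<forall>s\<in>{0, 1, \<eta>}. \<forall>t\<in>{0, 1, \<eta>}. \<forall>x\<in>eigenspace a s. \<forall>y\<in>eigenspace a t.
        x \<cdot> y \<in> eigenspace_sum a (fusion \<Phi> \<eta> s t))"

definition subalgebra :: "'m set \<Rightarrow> bool" where
  "subalgebra S \<longleftrightarrow> subspace S \<and> (\<forall>x\<in>S. \<forall>y\<in>S. x \<cdot> y \<in> S)"

definition two_generated :: "'f set \<Rightarrow> 'f \<Rightarrow> 'm \<Rightarrow> 'm \<Rightarrow> bool" where
  "two_generated \<Phi> \<eta> a b \<longleftrightarrow> axis \<Phi> \<eta> a \<and> axis \<Phi> \<eta> b \<and> subalgebra hull {a, b} = UNIV"

end


section \<open>Constructions of algebras and isomorphism\<close>

text \<open>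
  The explicit carrier is there for the sake of quotient algebras, whose elements are cosets.
\<close>

record ('f, 'a) alg =
  carrier :: "'a set"
  add :: "'a \<Rightarrow> 'a \<Rightarrow> 'a"
  smult :: "'f \<Rightarrow> 'a \<Rightarrow> 'a"
  mult :: "'a \<Rightarrow> 'a \<Rightarrow> 'a"

definition type_alg ::
  "('f \<Rightarrow> 'm \<Rightarrow> 'm) \<Rightarrow> ('m \<Rightarrow> 'm \<Rightarrow> 'm) \<Rightarrow> ('f, 'm::ab_group_add) alg" where
  "type_alg scale m = \<lparr>carrier = UNIV, add = (+), smult = scale, mult = m\<rparr>"

definition direct_sum :: "('f, 'a) alg \<Rightarrow> ('f, 'b) alg \<Rightarrow> ('f, 'a \<times> 'b) alg" (infixr \<open>\<oplus>\<close> 65) where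
  "A \<oplus> B =
    \<lparr>carrier = carrier A \<times> carrier B,
     add = (\<lambda>x y. (add A (fst x) (fst y), add B (snd x) (snd y))),
     smult = (\<lambda>c x. (smult A c (fst x), smult B c (snd x))),
     mult = (\<lambda>x y. (mult A (fst x) (fst y), mult B (snd x) (snd y)))\<rparr>"

definition coset :: "('f, 'a) alg \<Rightarrow> 'a set \<Rightarrow> 'a \<Rightarrow> 'a set" where
  "coset A I x = (\<lambda>i. add A x i) ` I"

definition quotient_alg :: "('f, 'a) alg \<Rightarrow> 'a set \<Rightarrow> ('f, 'a set) alg" where
  "quotient_alg A I =
    \<lparr>carrier = coset A I ` carrier A,
     add = (\<lambda>X Y. \<Union>x\<in>X. \<Union>y\<in>Y. coset A I (add A x y)),
     smult = (\<lambda>c X. \<Union>x\<in>X. coset A I (smult A c x)),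
     mult = (\<lambda>X Y. \<Union>x\<in>X. \<Union>y\<in>Y. coset A I (mult A x y))\<rparr>"

text \<open>
  An algebra with a basis indexed by a finite type: elements are coordinate functions, and
  \<open>c i j k\<close> is the coefficient at the \<open>k\<close>-th basis vector of the product of the \<open>i\<close>-th and the
  \<open>j\<close>-th one.
\<close>

definition basis_alg :: "('i::finite \<Rightarrow> 'i \<Rightarrow> 'i \<Rightarrow> 'f::field) \<Rightarrow> ('f, 'i \<Rightarrow> 'f) alg" where
  "basis_alg c =
    \<lparr>carrier = UNIV,
     add = (\<lambda>x y k. x k + y k),
     smult = (\<lambda>r x k. r * x k),
     mult = (\<lambda>x y k. \<Sum>i\<in>UNIV. \<Sum>j\<in>UNIV. x i * y j * c i j k)\<rparr>"

definition basis_vec :: "'i \<Rightarrow> 'i \<Rightarrow> 'f::field" where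
  "basis_vec i = (\<lambda>k. if k = i then 1 else 0)"

text \<open>
  A pair \<open>(A, S)\<close> stands for the algebra \<open>A\<close> together with its set \<open>S\<close> of generating axes;
  isomorphisms respect the generating axes. (As mere algebras, \<open>\<FF>a \<oplus> \<FF>b\<close> with generators
  \<open>a, a + b\<close> and with generators \<open>a, b\<close> would not be distinguished.)
\<close>

type_synonym ('f, 'a) axial = "('f, 'a) alg \<times> 'a set"

definition isomorphic :: "('f, 'a) axial \<Rightarrow> ('f, 'b) axial \<Rightarrow> bool" (infix \<open>\<cong>\<close> 50) where
  "X \<cong> Y \<longleftrightarrow>
    (case (X, Y) of ((A, S), (B, T)) \<Rightarrow>
      \<exists>f. bij_betw f (carrier A) (carrier B) \<and>
        (\<forall>x\<in>carrier A. \<forall>y\<in>carrier A. f (add A x y) = add B (f x) (f y)) \<and>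
        (\<forall>c. \<forall>x\<in>carrier A. f (smult A c x) = smult B c (f x)) \<and>
        (\<forall>x\<in>carrier A. \<forall>y\<in>carrier A. f (mult A x y) = mult B (f x) (f y)) \<and>
        f ` S = T)"

definition axial_quotient :: "('f, 'a) axial \<Rightarrow> 'a \<Rightarrow> ('f, 'a set) axial" where
  "axial_quotient X v =
    (case X of (A, S) \<Rightarrow>
      let I = range (\<lambda>c. smult A c v) in (quotient_alg A I, coset A I ` S))"


section \<open>The algebras of the classification\<close>

text \<open>The one-dimensional algebra spanned by an idempotent, which is the element \<open>1\<close>.\<close>

definition line_alg :: "('f::field, 'f) alg" where
  "line_alg = \<lparr>carrier = UNIV, add = (+), smult = (*), mult = (*)\<rparr>"

definition alg_2A :: "('f::field, 'f \<times> 'f) alg" where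
  "alg_2A = line_alg \<oplus> line_alg"

text \<open>
  The index type \<open>3\<close> has exactly the elements \<open>-1, 0, 1\<close>; for \<open>i \<noteq> j\<close> the case
  \<open>k \<notin> {i, j}\<close> is the remaining index.
\<close>

definition alg_3C :: "'f::field \<Rightarrow> ('f, 3 \<Rightarrow> 'f) alg" where
  "alg_3C \<eta> = basis_alg (\<lambda>i j.
     if i = j then basis_vec i
     else (\<lambda>k. if k \<in> {i, j} then \<eta> / 2 else - (\<eta> / 2)))"

text \<open>Here \<open>None\<close> is the index of \<open>q\<close>, and \<open>Some i\<close> that of the \<open>i\<close>-th axis.\<close>

fun hat_3C_coeff :: "'f::field \<Rightarrow> 3 option \<Rightarrow> 3 option \<Rightarrow> 3 option \<Rightarrow> 'f" where
  "hat_3C_coeff \<eta> None j = (\<lambda>k. (\<eta> + 1) * basis_vec j k)"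
| "hat_3C_coeff \<eta> (Some i) None = (\<lambda>k. (\<eta> + 1) * basis_vec (Some i) k)"
| "hat_3C_coeff \<eta> (Some i) (Some j) =
     (if i = j then basis_vec (Some i)
      else (\<lambda>k. case k of None \<Rightarrow> - (1 / 2)
                | Some k' \<Rightarrow> if k' \<in> {i, j} then (\<eta> + 1) / 2 else (1 - \<eta>) / 2))"

definition alg_hat_3C :: "'f::field \<Rightarrow> ('f, 3 option \<Rightarrow> 'f) alg" where
  "alg_hat_3C \<eta> = basis_alg (hat_3C_coeff \<eta>)"

abbreviation a_vec :: "3 \<Rightarrow> 3 \<Rightarrow> 'f::field" where
  "a_vec i \<equiv> basis_vec i"

abbreviation hat_a_vec :: "3 \<Rightarrow> 3 option \<Rightarrow> 'f::field" where
  "hat_a_vec i \<equiv> basis_vec (Some i)"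

abbreviation hat_q_vec :: "3 option \<Rightarrow> 'f::field" where
  "hat_q_vec \<equiv> basis_vec None"

definition a_sum :: "3 \<Rightarrow> 'f::field" where
  "a_sum = (\<lambda>k. a_vec 0 k + a_vec 1 k + a_vec (-1) k)"

definition ax_1A :: "('f::field, 'f) axial" where
  "ax_1A = (line_alg, {1, 1})"

definition ax_hat_1A :: "('f::field, 'f \<times> 'f) axial" where
  "ax_hat_1A = (line_alg \<oplus> line_alg, {(1, 0), (1, 1)})"

definition ax_2A :: "('f::field, 'f \<times> 'f) axial" where
  "ax_2A = (alg_2A, {(1, 0), (0, 1)})"

definition ax_hat_2A :: "('f::field, 'f \<times> 'f \<times> 'f) axial" where
  "ax_hat_2A = (line_alg \<oplus> alg_2A, {(1, 1, 0), (1, 0, 1)})"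

definition ax_3C :: "'f::field \<Rightarrow> ('f, 3 \<Rightarrow> 'f) axial" where
  "ax_3C \<eta> = (alg_3C \<eta>, {a_vec 0, a_vec 1})"

definition ax_hat_3C :: "'f::field \<Rightarrow> ('f, 3 option \<Rightarrow> 'f) axial" where
  "ax_hat_3C \<eta> = (alg_hat_3C \<eta>, {hat_a_vec 0, hat_a_vec 1})"

definition ax_3C0 :: "'f::field \<Rightarrow> ('f, (3 \<Rightarrow> 'f) \<times> 'f) axial" where
  "ax_3C0 \<eta> = (alg_3C \<eta> \<oplus> line_alg, {(a_vec 0, 0), (a_vec 1, 1)})"

definition ax_3C00 :: "'f::field \<Rightarrow> ('f, (3 \<Rightarrow> 'f) \<times> 'f \<times> 'f) axial" where
  "ax_3C00 \<eta> = (alg_3C \<eta> \<oplus> alg_2A, {(a_vec 0, 1, 0), (a_vec 1, 0, 1)})"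

definition ax_hat_3C0 :: "'f::field \<Rightarrow> ('f, (3 option \<Rightarrow> 'f) \<times> 'f) axial" where
  "ax_hat_3C0 \<eta> = (alg_hat_3C \<eta> \<oplus> line_alg, {(hat_a_vec 0, 0), (hat_a_vec 1, 1)})"

definition ax_hat_3C00 :: "'f::field \<Rightarrow> ('f, (3 option \<Rightarrow> 'f) \<times> 'f \<times> 'f) axial" where
  "ax_hat_3C00 \<eta> = (alg_hat_3C \<eta> \<oplus> alg_2A, {(hat_a_vec 0, 1, 0), (hat_a_vec 1, 0, 1)})"

definition ax_3C_cross :: "('f::field, (3 \<Rightarrow> 'f) set) axial" where
  "ax_3C_cross = axial_quotient (ax_3C (-1)) a_sum"

definition ax_3C0_cross :: "('f::field, ((3 \<Rightarrow> 'f) \<times> 'f) set) axial" where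
  "ax_3C0_cross = axial_quotient (ax_3C0 (-1)) (a_sum, 0)"

definition ax_3C00_cross :: "('f::field, ((3 \<Rightarrow> 'f) \<times> 'f \<times> 'f) set) axial" where
  "ax_3C00_cross = axial_quotient (ax_3C00 (-1)) (a_sum, 0, 0)"

definition ax_hat_3C_cross :: "('f::field, (3 option \<Rightarrow> 'f) set) axial" where
  "ax_hat_3C_cross = axial_quotient (ax_hat_3C (-1)) hat_q_vec"

definition ax_hat_3C0_cross :: "('f::field, ((3 option \<Rightarrow> 'f) \<times> 'f) set) axial" where
  "ax_hat_3C0_cross = axial_quotient (ax_hat_3C0 (-1)) (hat_q_vec, 0)"

definition ax_hat_3C00_cross :: "('f::field, ((3 option \<Rightarrow> 'f) \<times> 'f \<times> 'f) set) axial" where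
  "ax_hat_3C00_cross = axial_quotient (ax_hat_3C00 (-1)) (hat_q_vec, 0, 0)"

definition isomorphic_to_one_of_ten :: "('f::field, 'a) axial \<Rightarrow> 'f \<Rightarrow> bool" where
  "isomorphic_to_one_of_ten X \<eta> \<longleftrightarrow>
     X \<cong> ax_1A \<or> X \<cong> ax_hat_1A \<or> X \<cong> ax_2A \<or> X \<cong> ax_hat_2A \<or>
     X \<cong> ax_3C \<eta> \<or> X \<cong> ax_hat_3C \<eta> \<or> X \<cong> ax_3C0 \<eta> \<or> X \<cong> ax_3C00 \<eta> \<or>
     X \<cong> ax_hat_3C0 \<eta> \<or> X \<cong> ax_hat_3C00 \<eta>"

end

theory Submission
  imports Defs
begin

text \<open>
  Write \<open>\<phi>\<close> for the eigenvalue with \<open>M(a,0) M(a,1) \<subseteq> M(a,\<phi>)\<close>. The projection of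
  \<open>M(a,0) \<oplus> M(a,1)\<close> to its summand for \<open>1 - \<phi>\<close> is then multiplicative.

  The Miyamoto involutions of \<open>a\<close> and \<open>b\<close> generate a dihedral group, and the images of \<open>a\<close> and
  \<open>b\<close> form a sequence \<open>al n\<close> with \<open>al 0 = a\<close>, \<open>al 1 = b\<close>, on which the involution of \<open>al n\<close>
  acts as the reflection \<open>m \<mapsto> 2n - m\<close>. The element \<open>p = al n \<cdot> al (n+1) - \<eta> (al n + al (n+1))\<close>
  does not depend on \<open>n\<close>, and \<open>r n = al n \<cdot> al (n+2) - \<eta> (al n + al (n+2))\<close> has period 2. The
  multiplicativity of the projection for \<open>al n\<close> expresses \<open>p \<cdot> p\<close> linearly in terms of elements
  near \<open>n\<close>; comparing two consecutive values of \<open>n\<close> gives a linear recurrence for \<open>al\<close> with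
  characteristic polynomial \<open>(1+x)(1-x\<^sup>3)(\<kappa>(1+x\<^sup>2)/2 - x)\<close>, where \<open>\<kappa> = \<eta>\<close> or \<open>1 - \<eta>\<close>. The
  products with \<open>r\<close> remove the quadratic factor. Then \<open>\<delta> n = al (n+2) - al (n-1)\<close> alternates in
  sign, the elements \<open>s n = al n \<cdot> \<delta> n\<close> are two orthogonal idempotents in turn, and the
  \<open>al n - s n\<close> have period 3 and satisfy the multiplication table of the algebra \<open>3C\<close> with a hat.
  Hence \<open>M\<close> is a quotient of the direct sum of that algebra and \<open>2A\<close>, and the ideals of this sum
  are easily listed.
\<close>

section \<open>Linear identities\<close>

context comm_algebra
begin

definition coordinate :: "'m \<Rightarrow> 'm \<Rightarrow> 'f" where
  "coordinate i x = representation (extend_basis {}) x i"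

lemma independent_span_extend_basis_empty:
  "independent (extend_basis {})" "span (extend_basis {}) = UNIV"
  by (simp_all add: independent_extend_basis independent_empty)

lemma coordinate_add: "coordinate i (x + y) = coordinate i x + coordinate i y"
  and coordinate_diff: "coordinate i (x - y) = coordinate i x - coordinate i y"
  and coordinate_minus: "coordinate i (- x) = - coordinate i x"
  and coordinate_scale: "coordinate i (c *s x) = c * coordinate i x"
  and coordinate_zero: "coordinate i 0 = 0"
  by (simp_all add: coordinate_def independent_span_extend_basis_empty representation_add
      representation_diff representation_neg representation_scale representation_zero)

lemmas coordinate_simps =
  coordinate_add coordinate_diff coordinate_minus coordinate_scale coordinate_zero

lemma coordinate_eqI:
  assumes "\<And>i. coordinate i x = coordinate i y"
  shows "x = y"
proof -
  let ?R = "representation (extend_basis {})"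
  have "?R x = ?R y" using assms by (auto simp: coordinate_def)
  moreover have "z = (\<Sum>b | ?R z b \<noteq> 0. ?R z b *s b)" for z
    by (simp add: independent_span_extend_basis_empty sum_nonzero_representation_eq)
  ultimately show ?thesis by metis
qed

text \<open>
  To derive a linear identity between vectors from others, introduce \<open>coordinate_eqI\<close>, eliminate
  the premises with \<open>coordinate_eqE\<close>, and apply \<open>algebra\<close> to the resulting scalar identities.
\<close>

lemma coordinate_eqE:
  assumes "u = v" and "coordinate i u = coordinate i v \<Longrightarrow> coordinate i x = coordinate i y"
  shows "coordinate i x = coordinate i y"
  using assms by simp

lemma mult_add_right: "x \<cdot> (y + z) = x \<cdot> y + x \<cdot> z"
  by (metis mult_commute mult_add_left)

lemma mult_scale_right: "x \<cdot> (c *s z) = c *s (x \<cdot> z)"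
  by (metis mult_commute mult_scale_left)

lemma mult_zero_left [simp]: "0 \<cdot> x = 0"
  by (metis scale_zero_left mult_scale_left)

lemma mult_zero_right [simp]: "x \<cdot> 0 = 0"
  by (metis mult_commute mult_zero_left)

lemma mult_minus_left: "(- x) \<cdot> y = - (x \<cdot> y)"
  by (metis scale_minus_left scale_one mult_scale_left)

lemma mult_minus_right: "x \<cdot> (- y) = - (x \<cdot> y)"
  by (metis mult_commute mult_minus_left)

lemma mult_diff_left: "(x - y) \<cdot> z = x \<cdot> z - y \<cdot> z"
  by (metis mult_add_left mult_minus_left diff_conv_add_uminus)

lemma mult_diff_right: "z \<cdot> (x - y) = z \<cdot> x - z \<cdot> y"
  by (metis mult_commute mult_diff_left)

lemmas bilinear = mult_add_left mult_add_right mult_diff_left mult_diff_right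
  mult_minus_left mult_minus_right mult_scale_left mult_scale_right

lemma mult_sum_left: "(\<Sum>i\<in>I. x i) \<cdot> y = (\<Sum>i\<in>I. x i \<cdot> y)"
  by (induction I rule: infinite_finite_induct) (simp_all add: mult_add_left)

lemma mult_sum_right: "y \<cdot> (\<Sum>i\<in>I. x i) = (\<Sum>i\<in>I. y \<cdot> x i)"
  by (induction I rule: infinite_finite_induct) (simp_all add: mult_add_right)

end

section \<open>Graded axes\<close>

context comm_algebra
begin

definition axis_even :: "'m \<Rightarrow> 'm \<Rightarrow> bool" where
  "axis_even a x \<longleftrightarrow> a \<cdot> (a \<cdot> x) = a \<cdot> x"

text \<open>
  The automorphism that negates the \<open>\<eta>\<close>-component \<open>y\<close> of \<open>x\<close>: indeed
  \<open>a \<cdot> x - a \<cdot> (a \<cdot> x) = \<eta>(1 - \<eta>) y\<close>.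
\<close>

definition miyamoto :: "'f \<Rightarrow> 'm \<Rightarrow> 'm \<Rightarrow> 'm" where
  "miyamoto \<eta> a x = x - (2 / (\<eta> * (1 - \<eta>))) *s (a \<cdot> x - a \<cdot> (a \<cdot> x))"

text \<open>
  The projection of an even vector to the eigenvalue \<open>1 - \<phi>\<close>. It is multiplicative since
  products of eigenvectors for \<open>0\<close> and \<open>1\<close> belong to \<open>\<phi>\<close>.
\<close>

definition even_proj :: "'f \<Rightarrow> 'm \<Rightarrow> 'm \<Rightarrow> 'm" where
  "even_proj \<phi> a x = \<phi> *s x + (1 - 2 * \<phi>) *s (a \<cdot> x)"

lemma even_proj_linear:
  "even_proj \<phi> a (x + y) = even_proj \<phi> a x + even_proj \<phi> a y"
  "even_proj \<phi> a (x - y) = even_proj \<phi> a x - even_proj \<phi> a y"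
  "even_proj \<phi> a (c *s x) = c *s even_proj \<phi> a x"
  by (simp_all add: even_proj_def bilinear scale_right_distrib scale_right_diff_distrib ac_simps
      algebra_simps)

definition algebra_automorphism :: "('m \<Rightarrow> 'm) \<Rightarrow> bool" where
  "algebra_automorphism g \<longleftrightarrow> bij g \<and> (\<forall>x y. g (x + y) = g x + g y) \<and>
    (\<forall>c x. g (c *s x) = c *s g x) \<and> (\<forall>x y. g (x \<cdot> y) = g x \<cdot> g y)"

lemma algebra_automorphism_simps:
  assumes "algebra_automorphism g"
  shows "g (x + y) = g x + g y" "g (c *s x) = c *s g x" "g (x \<cdot> y) = g x \<cdot> g y"
    "g (x - y) = g x - g y" "g 0 = 0"
proof -
  show add: "g (x + y) = g x + g y" and scale: "g (c *s x) = c *s g x"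
    and "g (x \<cdot> y) = g x \<cdot> g y" for x y c
    using assms by (auto simp: algebra_automorphism_def)
  show "g 0 = 0" using scale[of 0 0] by simp
  show "g (x - y) = g x - g y" using add[of "x - y" y] by (simp add: algebra_simps)
qed

lemma miyamoto_image:
  assumes "algebra_automorphism g"
  shows "g (miyamoto \<eta> a x) = miyamoto \<eta> (g a) (g x)"
  unfolding miyamoto_def by (simp add: algebra_automorphism_simps[OF assms])

end

locale graded_axis = comm_algebra scale mult
  for scale :: "'f::field \<Rightarrow> 'm::ab_group_add \<Rightarrow> 'm" (infixr \<open>*s\<close> 75)
    and mult :: "'m \<Rightarrow> 'm \<Rightarrow> 'm" (infixl \<open>\<cdot>\<close> 70) +
  fixes \<phi> \<eta> :: 'f and a :: 'm
  assumes \<phi>_cases: "\<phi> = 0 \<or> \<phi> = 1" and \<eta>_neq_0: "\<eta> \<noteq> 0" and \<eta>_neq_1: "\<eta> \<noteq> 1"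
    and idem: "a \<cdot> a = a"
    and decomposition:
      "\<exists>x0 x1 xe. a \<cdot> x0 = 0 \<and> a \<cdot> x1 = x1 \<and> a \<cdot> xe = \<eta> *s xe \<and> x = x0 + x1 + xe"
    and fusion_00: "a \<cdot> x = 0 \<Longrightarrow> a \<cdot> y = 0 \<Longrightarrow> a \<cdot> (x \<cdot> y) = 0"
    and fusion_11: "a \<cdot> x = x \<Longrightarrow> a \<cdot> y = y \<Longrightarrow> a \<cdot> (x \<cdot> y) = x \<cdot> y"
    and fusion_01: "a \<cdot> x = 0 \<Longrightarrow> a \<cdot> y = y \<Longrightarrow> a \<cdot> (x \<cdot> y) = \<phi> *s (x \<cdot> y)"
    and fusion_0\<eta>: "a \<cdot> x = 0 \<Longrightarrow> a \<cdot> y = \<eta> *s y \<Longrightarrow> a \<cdot> (x \<cdot> y) = \<eta> *s (x \<cdot> y)"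
    and fusion_1\<eta>: "a \<cdot> x = x \<Longrightarrow> a \<cdot> y = \<eta> *s y \<Longrightarrow> a \<cdot> (x \<cdot> y) = \<eta> *s (x \<cdot> y)"
    and fusion_\<eta>\<eta>: "a \<cdot> x = \<eta> *s x \<Longrightarrow> a \<cdot> y = \<eta> *s y \<Longrightarrow> axis_even a (x \<cdot> y)"
begin

lemma \<phi>_idem: "\<phi> * \<phi> = \<phi>"
  using \<phi>_cases by auto

lemma even_components:
  assumes "axis_even a x"
  obtains x0 x1 where "x = x0 + x1" "a \<cdot> x0 = 0" "a \<cdot> x1 = x1"
  using that[of "x - a \<cdot> x" "a \<cdot> x"] assms by (simp add: axis_even_def mult_diff_right)

lemma even_mult_even:
  assumes "axis_even a x" "axis_even a y"
  shows "axis_even a (x \<cdot> y)"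
    and even_proj_mult: "even_proj \<phi> a (x \<cdot> y) = even_proj \<phi> a x \<cdot> even_proj \<phi> a y"
proof -
  obtain x0 x1 where x: "x = x0 + x1" "a \<cdot> x0 = 0" "a \<cdot> x1 = x1"
    using assms(1) by (rule even_components)
  obtain y0 y1 where y: "y = y0 + y1" "a \<cdot> y0 = 0" "a \<cdot> y1 = y1"
    using assms(2) by (rule even_components)
  have products: "a \<cdot> (x0 \<cdot> y0) = 0" "a \<cdot> (x1 \<cdot> y1) = x1 \<cdot> y1"
    "a \<cdot> (x0 \<cdot> y1) = \<phi> *s (x0 \<cdot> y1)" "a \<cdot> (x1 \<cdot> y0) = \<phi> *s (x1 \<cdot> y0)"
    using x y fusion_01[of y0 x1] by (simp_all add: fusion_00 fusion_11 fusion_01 mult_commute)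
  show "axis_even a (x \<cdot> y)"
    by (simp add: axis_even_def x y bilinear products \<phi>_idem)
  show "even_proj \<phi> a (x \<cdot> y) = even_proj \<phi> a x \<cdot> even_proj \<phi> a y"
    using \<phi>_cases by (auto simp: even_proj_def x y bilinear products)
qed

lemma mult_even_proj:
  assumes "axis_even a x"
  shows "a \<cdot> even_proj \<phi> a x = (1 - \<phi>) *s even_proj \<phi> a x"
  using assms \<phi>_cases by (auto simp: even_proj_def axis_even_def mult_diff_right)

lemma miyamoto_even: "axis_even a x \<Longrightarrow> miyamoto \<eta> a x = x"
  by (simp add: miyamoto_def axis_even_def)

lemma miyamoto_odd:
  assumes "a \<cdot> x = \<eta> *s x"
  shows "miyamoto \<eta> a x = - x"
proof -
  have "a \<cdot> x - a \<cdot> (a \<cdot> x) = (\<eta> * (1 - \<eta>)) *s x"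
    by (simp add: assms mult_scale_right algebra_simps)
  then have "miyamoto \<eta> a x = x - 2 *s x"
    unfolding miyamoto_def using \<eta>_neq_0 \<eta>_neq_1 by simp
  also have "\<dots> = - x"
    by (rule coordinate_eqI, unfold coordinate_simps, algebra)
  finally show ?thesis .
qed

lemma miyamoto_add: "miyamoto \<eta> a (x + y) = miyamoto \<eta> a x + miyamoto \<eta> a y"
  and miyamoto_scale: "miyamoto \<eta> a (c *s x) = c *s miyamoto \<eta> a x"
  by (simp_all add: miyamoto_def bilinear scale_right_distrib scale_right_diff_distrib ac_simps)

lemma even_odd_components:
  obtains u v where "x = u + v" "axis_even a u" "a \<cdot> v = \<eta> *s v" "miyamoto \<eta> a x = u - v"
proof -
  obtain x0 x1 xe where x: "a \<cdot> x0 = 0" "a \<cdot> x1 = x1" "a \<cdot> xe = \<eta> *s xe" "x = x0 + x1 + xe"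
    using decomposition by blast
  then have "axis_even a (x0 + x1)" by (simp add: axis_even_def bilinear)
  moreover from this have "miyamoto \<eta> a x = (x0 + x1) - xe"
    using x by (simp add: miyamoto_add[of "x0 + x1"] miyamoto_even miyamoto_odd)
  ultimately show ?thesis using x that by blast
qed

lemma even_mult_odd:
  assumes "axis_even a x" "a \<cdot> y = \<eta> *s y"
  shows "a \<cdot> (x \<cdot> y) = \<eta> *s (x \<cdot> y)"
proof -
  obtain x0 x1 where x: "x = x0 + x1" "a \<cdot> x0 = 0" "a \<cdot> x1 = x1"
    using assms(1) by (rule even_components)
  then show ?thesis
    using fusion_0\<eta>[of x0 y] fusion_1\<eta>[of x1 y] assms(2) by (simp add: bilinear scale_right_distrib)
qed

lemma miyamoto_mult: "miyamoto \<eta> a (x \<cdot> y) = miyamoto \<eta> a x \<cdot> miyamoto \<eta> a y"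
proof -
  obtain u v where x: "x = u + v" "axis_even a u" "a \<cdot> v = \<eta> *s v" "miyamoto \<eta> a x = u - v"
    by (rule even_odd_components)
  obtain u' v' where y: "y = u' + v'" "axis_even a u'" "a \<cdot> v' = \<eta> *s v'" "miyamoto \<eta> a y = u' - v'"
    by (rule even_odd_components)
  have even: "axis_even a (u \<cdot> u')" "axis_even a (v \<cdot> v')"
    using x y by (simp_all add: even_mult_even fusion_\<eta>\<eta>)
  have odd: "a \<cdot> (u \<cdot> v') = \<eta> *s (u \<cdot> v')" "a \<cdot> (v \<cdot> u') = \<eta> *s (v \<cdot> u')"
    using x y even_mult_odd[of u' v] by (simp_all add: even_mult_odd mult_commute[of v])
  show ?thesis
    unfolding x(4) y(4) unfolding x(1) y(1) bilinear miyamoto_add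
    by (simp add: miyamoto_even[OF even(1)] miyamoto_even[OF even(2)] miyamoto_odd[OF odd(1)]
        miyamoto_odd[OF odd(2)])
qed

lemma miyamoto_involution: "miyamoto \<eta> a (miyamoto \<eta> a x) = x"
proof -
  obtain u v where x: "x = u + v" "axis_even a u" "a \<cdot> v = \<eta> *s v" "miyamoto \<eta> a x = u - v"
    by (rule even_odd_components)
  have "miyamoto \<eta> a (u + - v) = u + v"
    using x(2,3)
    by (simp only: miyamoto_add) (simp add: miyamoto_even miyamoto_odd mult_minus_right)
  then show ?thesis using x by simp
qed

lemma miyamoto_automorphism: "algebra_automorphism (miyamoto \<eta> a)"
  using involuntory_imp_bij[of "miyamoto \<eta> a"]
  by (simp add: algebra_automorphism_def miyamoto_add miyamoto_scale miyamoto_mult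
      miyamoto_involution)

lemma miyamoto_self: "miyamoto \<eta> a a = a"
  by (simp add: miyamoto_even axis_even_def idem)

lemma mult_minus_miyamoto: "a \<cdot> (x - miyamoto \<eta> a x) = \<eta> *s (x - miyamoto \<eta> a x)"
proof -
  obtain u v where x: "x = u + v" "a \<cdot> v = \<eta> *s v" "miyamoto \<eta> a x = u - v"
    by (rule even_odd_components)
  then have "x - miyamoto \<eta> a x = v + v" by simp
  then show ?thesis using x by (simp add: bilinear scale_right_distrib)
qed

lemma even_plus_miyamoto: "axis_even a (x + miyamoto \<eta> a x)"
proof -
  obtain u v where x: "x = u + v" "axis_even a u" "miyamoto \<eta> a x = u - v"
    by (rule even_odd_components)
  then have "x + miyamoto \<eta> a x = u + u" by simp
  then show ?thesis using x by (simp add: axis_even_def bilinear)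
qed

lemma graded_axis_image:
  assumes g: "algebra_automorphism g"
  shows "graded_axis scale mult \<phi> \<eta> (g a)"
proof -
  note simps = algebra_automorphism_simps[OF g]
  have bij: "bij g" using g by (simp add: algebra_automorphism_def)
  have image: "\<exists>x'. x = g x'" for x using bij by (metis bij_pointE)
  have eq: "g a \<cdot> g x = g y \<longleftrightarrow> a \<cdot> x = y" for x y
    using bij by (simp add: bij_is_inj inj_eq flip: simps)
  have even: "axis_even (g a) (g x) \<longleftrightarrow> axis_even a x" for x
    using bij by (simp add: axis_even_def bij_is_inj inj_eq flip: simps)
  have components:
    "\<exists>x0 x1 xe. g a \<cdot> x0 = 0 \<and> g a \<cdot> x1 = x1 \<and> g a \<cdot> xe = \<eta> *s xe \<and> x = x0 + x1 + xe" for x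
  proof -
    obtain x' where x': "x = g x'" using image by blast
    obtain x0 x1 xe where "a \<cdot> x0 = 0" "a \<cdot> x1 = x1" "a \<cdot> xe = \<eta> *s xe" "x' = x0 + x1 + xe"
      using decomposition by blast
    then show ?thesis
      by (intro exI[of _ "g x0"] exI[of _ "g x1"] exI[of _ "g xe"])
        (simp add: x' simps flip: simps(3))
  qed
  show ?thesis
  proof
    fix x y
    obtain x' y' where xy: "x = g x'" "y = g y'" using image by blast
    note eqs = eq[of _ 0, unfolded simps] eq[of _ "_ *s _", unfolded simps] eq
    note prod = simps(3)[of x' y', symmetric]
    show "g a \<cdot> x = 0 \<Longrightarrow> g a \<cdot> y = 0 \<Longrightarrow> g a \<cdot> (x \<cdot> y) = 0"
      "g a \<cdot> x = x \<Longrightarrow> g a \<cdot> y = y \<Longrightarrow> g a \<cdot> (x \<cdot> y) = x \<cdot> y"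
      "g a \<cdot> x = 0 \<Longrightarrow> g a \<cdot> y = y \<Longrightarrow> g a \<cdot> (x \<cdot> y) = \<phi> *s (x \<cdot> y)"
      "g a \<cdot> x = 0 \<Longrightarrow> g a \<cdot> y = \<eta> *s y \<Longrightarrow> g a \<cdot> (x \<cdot> y) = \<eta> *s (x \<cdot> y)"
      "g a \<cdot> x = x \<Longrightarrow> g a \<cdot> y = \<eta> *s y \<Longrightarrow> g a \<cdot> (x \<cdot> y) = \<eta> *s (x \<cdot> y)"
      "g a \<cdot> x = \<eta> *s x \<Longrightarrow> g a \<cdot> y = \<eta> *s y \<Longrightarrow> axis_even (g a) (x \<cdot> y)"
      unfolding xy prod eqs even
      by (rule fusion_00 fusion_11 fusion_01 fusion_0\<eta> fusion_1\<eta> fusion_\<eta>\<eta>; assumption)+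
  qed (use \<phi>_cases \<eta>_neq_0 \<eta>_neq_1 idem components eq in auto)
qed

end

context comm_algebra
begin

lemma axis_fusion:
  assumes "axis \<Phi> \<eta> a" and "s \<in> {0, 1, \<eta>}" "t \<in> {0, 1, \<eta>}" and "a \<cdot> x = s *s x" "a \<cdot> y = t *s y"
  shows "x \<cdot> y \<in> eigenspace_sum a (fusion \<Phi> \<eta> s t)"
  using assms(1)[unfolded axis_def, THEN conjunct2, THEN conjunct2, THEN conjunct2, rule_format]
    assms(2-5)
  by (simp add: eigenspace_def)

lemma axis_decomposition:
  assumes "axis \<Phi> \<eta> a"
  shows "\<exists>x0 x1 xe. a \<cdot> x0 = 0 \<and> a \<cdot> x1 = x1 \<and> a \<cdot> xe = \<eta> *s xe \<and> x = x0 + x1 + xe"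
  using assms[unfolded axis_def, THEN conjunct2, THEN conjunct2, THEN conjunct1, rule_format,
      THEN ex1_implies_ex, of x]
  by (auto simp: eigenspace_def)

lemma eigenspace_sum_singleton: "eigenspace_sum a {u} = eigenspace a u"
  unfolding eigenspace_sum_def by auto

lemma axis_fusion_singleton:
  assumes "axis \<Phi> \<eta> a" and "s \<in> {0, 1, \<eta>}" "t \<in> {0, 1, \<eta>}" "fusion \<Phi> \<eta> s t = {u}"
    and "a \<cdot> x = s *s x" "a \<cdot> y = t *s y"
  shows "a \<cdot> (x \<cdot> y) = u *s (x \<cdot> y)"
  using axis_fusion[OF assms(1-3,5,6)] assms(4)
  by (simp add: eigenspace_sum_singleton eigenspace_def)

lemma graded_axis_if_axis:
  assumes axis: "axis \<Phi> \<eta> a" and \<Phi>: "\<Phi> \<subseteq> {0, 1}" "\<Phi> \<noteq> {0, 1}" and \<eta>: "\<eta> \<noteq> 0" "\<eta> \<noteq> 1"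
  shows "graded_axis scale mult (if \<Phi> = {1} then 1 else 0) \<eta> a"
proof
  let ?\<phi> = "if \<Phi> = {1} then 1 else 0"
  note product = axis_fusion_singleton[OF axis]
  fix x y
  show "?\<phi> = 0 \<or> ?\<phi> = 1" "\<eta> \<noteq> 0" "\<eta> \<noteq> 1" "a \<cdot> a = a"
    using \<eta> axis by (simp_all add: axis_def)
  show "\<exists>x0 x1 xe. a \<cdot> x0 = 0 \<and> a \<cdot> x1 = x1 \<and> a \<cdot> xe = \<eta> *s xe \<and> x = x0 + x1 + xe"
    using axis by (rule axis_decomposition)
  show "a \<cdot> (x \<cdot> y) = 0" if "a \<cdot> x = 0" "a \<cdot> y = 0"
    using product[of 0 0 0 x y] that by (simp add: fusion_def)
  show "a \<cdot> (x \<cdot> y) = x \<cdot> y" if "a \<cdot> x = x" "a \<cdot> y = y"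
    using product[of 1 1 1 x y] that by (simp add: fusion_def)
  show "a \<cdot> (x \<cdot> y) = \<eta> *s (x \<cdot> y)" if "a \<cdot> x = 0" "a \<cdot> y = \<eta> *s y"
    using product[of 0 \<eta> \<eta> x y] that \<eta> by (simp add: fusion_def)
  show "a \<cdot> (x \<cdot> y) = \<eta> *s (x \<cdot> y)" if "a \<cdot> x = x" "a \<cdot> y = \<eta> *s y"
    using product[of 1 \<eta> \<eta> x y] that \<eta> by (simp add: fusion_def)
  show "a \<cdot> (x \<cdot> y) = ?\<phi> *s (x \<cdot> y)" if "a \<cdot> x = 0" "a \<cdot> y = y"
  proof -
    have "x \<cdot> y \<in> eigenspace_sum a \<Phi>"
      using axis_fusion[OF axis, of 0 1 x y] that by (simp add: fusion_def)
    moreover have "\<Phi> = {} \<or> \<Phi> = {0} \<or> \<Phi> = {1}" using \<Phi> by blast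
    ultimately show ?thesis
      by (auto simp: eigenspace_sum_singleton) (auto simp: eigenspace_sum_def eigenspace_def)
  qed
  show "axis_even a (x \<cdot> y)" if "a \<cdot> x = \<eta> *s x" "a \<cdot> y = \<eta> *s y"
  proof -
    have "x \<cdot> y \<in> eigenspace_sum a {0, 1}"
      using axis_fusion[OF axis, of \<eta> \<eta> x y] that \<eta> by (simp add: fusion_def)
    then obtain u v where "x \<cdot> y = u + v" "a \<cdot> u = 0" "a \<cdot> v = v"
      by (auto simp: eigenspace_sum_def eigenspace_def)
    then show ?thesis by (simp add: axis_even_def mult_add_right)
  qed
qed

end

section \<open>Sequences of axes\<close>

lemma two_sided_orbit:
  assumes f: "bij_betw f S S" and x: "x \<in> S"
  obtains u :: "int \<Rightarrow> 'a" where "u 0 = x" "\<And>n. u n \<in> S" "\<And>n. u (n + 1) = f (u n)"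
proof -
  define g where "g = inv_into S f"
  define u where "u n = (if n \<ge> 0 then (f ^^ nat n) x else (g ^^ nat (- n)) x)" for n :: int
  have S: "f y \<in> S" "g y \<in> S" "f (g y) = y" if "y \<in> S" for y
    using f that bij_betw_apply[OF f] bij_betw_apply[OF bij_betw_inv_into[OF f]]
      bij_betw_inv_into_right[OF f] by (auto simp: g_def)
  have pos: "(f ^^ k) x \<in> S" and neg: "(g ^^ k) x \<in> S" for k
    by (induction k) (simp_all add: x S)
  have "u (n + 1) = f (u n)" for n
  proof (cases "n \<ge> 0")
    case True
    then show ?thesis by (simp add: u_def nat_add_distrib)
  next
    case False
    then have "nat (- n) = Suc (nat (- n - 1))" by simp
    then have "f (u n) = (g ^^ nat (- n - 1)) x" using False neg by (simp add: u_def S)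
    then show ?thesis using False by (auto simp: u_def)
  qed
  then show ?thesis using that[of u] pos neg by (simp add: u_def)
qed

lemma int_shift_simps:
  fixes n :: int
  shows "n + 1 + 1 = n + 2" "n + 1 + 2 = n + 3" "n + 1 - 1 = n" "n + 1 - 2 = n - 1"
    "n + 2 + 1 = n + 3" "n + 2 + 2 = n + 4" "n + 2 - 1 = n + 1" "n + 2 - 2 = n"
    "n - 1 + 1 = n" "n - 1 + 2 = n + 1" "n - 1 - 1 = n - 2" "n - 1 - 2 = n - 3"
    "n - 2 + 1 = n - 1" "n - 2 + 2 = n" "n - 2 - 1 = n - 3" "n - 2 - 2 = n - 4"
    "n + 3 + 1 = n + 4" "n + 3 - 1 = n + 2" "n + 3 - 2 = n + 1" "n - 1 + 3 = n + 2"
    "n + 4 + 1 = n + 5" "n + 4 + 2 = n + 6" "n + 4 - 1 = n + 3" "n + 4 - 2 = n + 2"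
    "2 * (1::int) = 2"
  by simp_all

locale axis_sequence = comm_algebra scale mult
  for scale :: "'f::field \<Rightarrow> 'm::ab_group_add \<Rightarrow> 'm" (infixr \<open>*s\<close> 75)
    and mult :: "'m \<Rightarrow> 'm \<Rightarrow> 'm" (infixl \<open>\<cdot>\<close> 70) +
  fixes \<phi> \<eta> :: 'f and al :: "int \<Rightarrow> 'm"
  assumes graded_axis: "graded_axis scale mult \<phi> \<eta> (al n)"
    and reflection: "miyamoto \<eta> (al n) (al m) = al (2 * n - m)"
    and two_neq_0: "(2::'f) \<noteq> 0" and \<eta>_neq_half: "2 * \<eta> \<noteq> 1"

context comm_algebra
begin

lemma axis_sequence_if_step:
  assumes axis: "\<And>n. graded_axis scale mult \<phi> \<eta> (al n)"
    and step: "\<And>n. al (n + 1) = miyamoto \<eta> (al n) (al (n - 1))"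
    and neq: "(2::'f) \<noteq> 0" "2 * \<eta> \<noteq> 1"
  shows "axis_sequence scale mult \<phi> \<eta> al"
proof -
  let ?t = "\<lambda>n. miyamoto \<eta> (al n)"
  note involution = graded_axis.miyamoto_involution[OF axis]
  note conjugation = miyamoto_image[OF graded_axis.miyamoto_automorphism[OF axis]]
  have backward: "?t n (al (n + 1)) = al (n - 1)" for n
    by (simp add: step involution)
  have forward: "?t n (al (n + int k)) = al (n - int k) \<and>
      ?t n (al (n + int (Suc k))) = al (n - int (Suc k))" for n k
  proof (induction k)
    case 0
    show ?case using backward graded_axis.miyamoto_self[OF axis] by simp
  next
    case (Suc k)
    have "?t n (al (n + int (Suc k) + 1)) = ?t (n - int (Suc k)) (al (n - int (Suc k) + 1))"
      using Suc unfolding step[of "n + int (Suc k)"] conjugation by simp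
    then show ?case using Suc backward[of "n - int (Suc k)"] by (simp add: algebra_simps)
  qed
  have "?t n (al m) = al (2 * n - m)" for n m
  proof (cases "m \<ge> n")
    case True
    then show ?thesis using forward[of n "nat (m - n)"] by simp
  next
    case False
    then have "?t n (al (2 * n - m)) = al m" using forward[of n "nat (n - m)"] by simp
    then show ?thesis by (metis involution)
  qed
  then show ?thesis
    using axis neq by (intro axis_sequence.intro axis_sequence_axioms.intro comm_algebra_axioms)
qed

lemma axis_sequence_exists:
  assumes "graded_axis scale mult \<phi> \<eta> a" "graded_axis scale mult \<phi> \<eta> b"
    and "(2::'f) \<noteq> 0" "2 * \<eta> \<noteq> 1"
  obtains al where "axis_sequence scale mult \<phi> \<eta> al" "al 0 = a" "al 1 = b"
proof -
  define S where "S = Collect (graded_axis scale mult \<phi> \<eta>)"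
  define f where "f = (\<lambda>(x, y). (y, miyamoto \<eta> y x))"
  define g where "g = (\<lambda>(x, y). (miyamoto \<eta> x y, x))"
  have image: "miyamoto \<eta> x y \<in> S" if "x \<in> S" "y \<in> S" for x y
    using that by (auto simp: S_def graded_axis.graded_axis_image graded_axis.miyamoto_automorphism)
  have start: "(a, b) \<in> S \<times> S" using assms(1,2) by (simp add: S_def)
  have bij: "bij_betw f (S \<times> S) (S \<times> S)"
    by (rule bij_betw_byWitness[of _ g])
      (auto simp: f_def g_def image, auto simp: S_def graded_axis.miyamoto_involution)
  obtain u :: "int \<Rightarrow> 'm \<times> 'm"
    where u: "u 0 = (a, b)" "\<And>n. u n \<in> S \<times> S" "\<And>n. u (n + 1) = f (u n)"
    by (rule two_sided_orbit[OF bij start]) (rule that)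
  have snd: "snd (u n) = fst (u (n + 1))" for n by (simp add: u f_def split: prod.split)
  have "axis_sequence scale mult \<phi> \<eta> (\<lambda>n. fst (u n))"
  proof (rule axis_sequence_if_step)
    show "graded_axis scale mult \<phi> \<eta> (fst (u n))" for n using u(2)[of n] by (auto simp: S_def)
    show "fst (u (n + 1)) = miyamoto \<eta> (fst (u n)) (fst (u (n - 1)))" for n
      using u(3)[of n] u(3)[of "n - 1"] by (simp add: f_def split: prod.splits)
  qed (rule assms(3,4))+
  then show ?thesis using that u snd[of 0] by simp
qed

end

context axis_sequence
begin

sublocale axis: graded_axis scale mult \<phi> \<eta> "al n" for n
  by (rule graded_axis)

text \<open>
  If \<open>\<phi> = 1\<close>, then \<open>1 - al n\<close>, in the algebra with a unit adjoined, behaves like an axis with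
  \<open>\<phi> = 0\<close> and with \<open>\<kappa> = 1 - \<eta>\<close> in place of \<open>\<eta>\<close>.
\<close>

definition \<kappa> :: 'f where "\<kappa> = \<phi> + (1 - 2 * \<phi>) * \<eta>"

abbreviation proj :: "int \<Rightarrow> 'm \<Rightarrow> 'm" where "proj n \<equiv> even_proj \<phi> (al n)"

lemma \<kappa>_neq: "\<kappa> \<noteq> 0" "\<kappa> \<noteq> 1" "2 * \<kappa> \<noteq> 1"
proof -
  have "2 * (1 - \<eta>) \<noteq> 1" using \<eta>_neq_half by algebra
  then show "\<kappa> \<noteq> 0" "\<kappa> \<noteq> 1" "2 * \<kappa> \<noteq> 1"
    using axis.\<phi>_cases axis.\<eta>_neq_0 axis.\<eta>_neq_1 \<eta>_neq_half by (auto simp: \<kappa>_def)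
qed

lemma four_neq_0: "(4::'f) \<noteq> 0"
  using two_neq_0 by (metis mult_2 mult_eq_0_iff numeral_Bit0)

definition sym_sum :: "int \<Rightarrow> int \<Rightarrow> 'm" where
  "sym_sum k n = al (n + k) + al (n - k)"

definition defect :: "int \<Rightarrow> int \<Rightarrow> 'm" where
  "defect k n = al n \<cdot> al (n + k) - \<eta> *s (al n + al (n + k))"

lemma sym_sum_even: "axis_even (al n) (sym_sum k n)"
  using axis.even_plus_miyamoto[of n "al (n + k)"] by (simp add: reflection sym_sum_def)

lemma mult_al_diff: "al n \<cdot> (al (n + k) - al (n - k)) = \<eta> *s (al (n + k) - al (n - k))"
  using axis.mult_minus_miyamoto[of n "al (n + k)"] by (simp add: reflection)

lemma mult_al_add: "al n \<cdot> al (n + k) = defect k n + \<eta> *s (al n + al (n + k))"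
  by (simp add: defect_def)

lemma mult_al_minus: "al n \<cdot> al (n - k) = defect k n + \<eta> *s (al n + al (n - k))"
  using mult_al_diff[of n k] by (simp add: defect_def bilinear algebra_simps)

lemma defect_minus: "defect k (n - k) = defect k n"
  using mult_al_minus[of n k] by (simp add: defect_def[of k "n - k"] mult_commute add.commute)

lemma defect_add: "defect k (n + k) = defect k n"
  using defect_minus[of k "n + k"] by simp

lemma mult_sym_sum:
  "al n \<cdot> sym_sum k n = 2 *s defect k n + (2 * \<eta>) *s al n + \<eta> *s sym_sum k n"
  unfolding sym_sum_def bilinear mult_al_add mult_al_minus
  by (rule coordinate_eqI, unfold coordinate_simps, algebra)

lemma mult_defect: "2 *s (al n \<cdot> defect k n) =
    (2 * (1 - \<eta>)) *s defect k n - (2 * \<eta>\<^sup>2) *s al n + (\<eta> * (1 - \<eta>)) *s sym_sum k n"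
proof -
  have "2 *s (al n \<cdot> defect k n) = (1 - \<eta>) *s (al n \<cdot> sym_sum k n) - (2 * \<eta>) *s al n"
    using arg_cong[OF mult_sym_sum[of n k], of "mult (al n)"] sym_sum_even[of n k]
    by (simp add: axis_even_def bilinear axis.idem algebra_simps)
  then show ?thesis
    unfolding mult_sym_sum
    by (intro coordinate_eqI) (elim coordinate_eqE, unfold coordinate_simps, algebra)
qed

lemma defect_even: "axis_even (al n) (defect k n)"
  unfolding axis_even_def
proof (rule scale_left_imp_eq[OF two_neq_0])
  show "2 *s (al n \<cdot> (al n \<cdot> defect k n)) = 2 *s (al n \<cdot> defect k n)"
    using arg_cong[OF mult_defect[of n k], of "mult (al n)"] mult_defect[of n k]
    unfolding bilinear mult_sym_sum axis.idem
    by (intro coordinate_eqI) (elim coordinate_eqE, unfold coordinate_simps, algebra)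
qed

lemma proj_al: "proj n (al n) = (1 - \<phi>) *s al n"
  by (simp add: even_proj_def axis.idem algebra_simps flip: scale_left_distrib)

lemma proj_sym_sum: "proj n (sym_sum k n) =
    \<kappa> *s sym_sum k n + (2 * (1 - 2 * \<phi>)) *s (defect k n + \<eta> *s al n)"
  unfolding even_proj_def mult_sym_sum \<kappa>_def
  by (rule coordinate_eqI, unfold coordinate_simps, algebra)

lemma proj_defect: "(2 * (1 - 2 * \<phi>)) *s proj n (defect k n) =
    (1 - \<kappa>) *s proj n (sym_sum k n) - (2 * (1 - 2 * \<phi>) * \<eta> * (1 - \<phi>)) *s al n"
  using mult_defect[of n k] axis.\<phi>_cases unfolding even_proj_def mult_sym_sum \<kappa>_def
  by (intro coordinate_eqI)
    (elim coordinate_eqE disjE; hypsubst; unfold coordinate_simps; algebra)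

lemma sym_sum_square: "sym_sum k n \<cdot> sym_sum k n =
    (1 + 2 * \<eta>) *s sym_sum k n + 2 *s defect (2 * k) (n + k)"
proof -
  have cross: "al (n + k) \<cdot> al (n - k) = defect (2 * k) (n + k) + \<eta> *s sym_sum k n"
    using mult_al_minus[of "n + k" "2 * k"] by (simp add: sym_sum_def)
  have "sym_sum k n \<cdot> sym_sum k n = sym_sum k n + 2 *s (al (n + k) \<cdot> al (n - k))"
    unfolding sym_sum_def bilinear axis.idem mult_commute[of "al (n - k)" "al (n + k)"]
    by (rule coordinate_eqI, unfold coordinate_simps, algebra)
  then show ?thesis
    unfolding cross by (simp add: algebra_simps)
qed

lemma defect_mult_sym_sum: "2 *s (defect k n \<cdot> sym_sum k n) =
    (\<eta> * (1 - \<eta>)) *s (2 *s al n + sym_sum (2 * k) n) + (4 * (1 - \<eta>)) *s defect k n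
      - (2 * \<eta>\<^sup>2) *s sym_sum k n"
proof -
  have indices: "n + k + k = n + 2 * k" "n - k - k = n - 2 * k" "n + k - k = n" "n - k + k = n"
    by simp_all
  have "2 *s (defect k n \<cdot> sym_sum k n) =
      2 *s (al (n + k) \<cdot> defect k n) + 2 *s (al (n - k) \<cdot> defect k n)"
    by (simp add: sym_sum_def mult_commute bilinear scale_right_distrib)
  then show ?thesis
    using mult_defect[of "n + k" k] mult_defect[of "n - k" k]
    unfolding defect_add defect_minus sym_sum_def indices
    by (intro coordinate_eqI) (elim coordinate_eqE, unfold coordinate_simps, algebra)
qed

lemma proj_sym_sum_square: "proj n (sym_sum k n) \<cdot> proj n (sym_sum k n) =
    2 *s proj n (sym_sum k n) + ((1 - 2 * \<phi>) * \<kappa>) *s proj n (sym_sum (2 * k) n)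
      - (2 * \<eta> * (1 - \<phi>)) *s al n"
proof -
  let ?X = "proj n (sym_sum k n)" and ?D = "proj n (defect k n)"
  have "2 *s (?D \<cdot> ?X) = (\<eta> * (1 - \<eta>)) *s ((2 * (1 - \<phi>)) *s al n + proj n (sym_sum (2 * k) n))
      + (4 * (1 - \<eta>)) *s ?D - (2 * \<eta>\<^sup>2) *s ?X"
    using arg_cong[OF defect_mult_sym_sum[of k n], of "proj n"]
    by (simp add: even_proj_linear axis.even_proj_mult defect_even sym_sum_even proj_al)
  moreover have "(2 * (1 - 2 * \<phi>)) *s (?D \<cdot> ?X) =
      (1 - \<kappa>) *s (?X \<cdot> ?X) - (2 * (1 - 2 * \<phi>) * \<eta> * (1 - \<phi>) * (1 - \<phi>)) *s ?X"
    using arg_cong[OF proj_defect[of n k], of "\<lambda>x. x \<cdot> ?X"]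
    by (simp add: bilinear axis.mult_even_proj sym_sum_even)
  moreover have "1 - \<kappa> \<noteq> 0" using \<kappa>_neq by simp
  ultimately have "(1 - \<kappa>) *s (?X \<cdot> ?X) = (1 - \<kappa>) *s (2 *s ?X
      + ((1 - 2 * \<phi>) * \<kappa>) *s proj n (sym_sum (2 * k) n) - (2 * \<eta> * (1 - \<phi>)) *s al n)"
    using proj_defect[of n k] axis.\<phi>_cases unfolding \<kappa>_def
    by (intro coordinate_eqI)
      (elim coordinate_eqE disjE; hypsubst; unfold coordinate_simps; algebra)
  then show ?thesis using \<kappa>_neq by (auto dest: scale_left_imp_eq)
qed

lemma proj_defect_double: "2 *s proj n (defect (2 * k) (n + k)) =
    (1 - 2 * \<eta>) *s proj n (sym_sum k n) + ((1 - 2 * \<phi>) * \<kappa>) *s proj n (sym_sum (2 * k) n)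
      - (2 * \<eta> * (1 - \<phi>)) *s al n"
proof -
  have "proj n (sym_sum k n) \<cdot> proj n (sym_sum k n) =
      (1 + 2 * \<eta>) *s proj n (sym_sum k n) + 2 *s proj n (defect (2 * k) (n + k))"
    using arg_cong[OF sym_sum_square[of k n], of "proj n"]
    by (simp add: even_proj_linear axis.even_proj_mult sym_sum_even)
  then show ?thesis
    unfolding proj_sym_sum_square
    by (intro coordinate_eqI) (elim coordinate_eqE, unfold coordinate_simps, algebra)
qed

lemma mult_defect_double: "2 *s (al n \<cdot> defect (2 * k) (n + k)) =
    (2 * \<phi>) *s defect (2 * k) (n + k) + (2 * (1 - 2 * \<eta>)) *s defect k n
      + (2 * (1 - 2 * \<phi>) * \<kappa>) *s defect (2 * k) n - (2 * \<eta>\<^sup>2) *s al n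
      + ((1 - 2 * \<kappa>) * \<kappa>) *s sym_sum k n + \<kappa>\<^sup>2 *s sym_sum (2 * k) n"
  using proj_defect_double[of n k] axis.\<phi>_cases
  unfolding proj_sym_sum even_proj_def[of _ _ "defect _ _"] \<kappa>_def
  by (intro coordinate_eqI)
    (elim coordinate_eqE disjE; hypsubst; unfold coordinate_simps; algebra)

lemma defect_square: "4 *s (defect k n \<cdot> defect k n) =
    ((2 * \<eta> - 1) * \<kappa>) *s
      (\<kappa> *s sym_sum (2 * k) n + (\<kappa> - 2) *s sym_sum k n + (2 * (\<kappa> - 1)) *s al n)
    + (2 * \<kappa>) *s defect (2 * k) n - (2 * \<kappa>\<^sup>2) *s defect (2 * k) (n + k)
    + (4 * (2 * (1 - \<eta>)\<^sup>2 - 1)) *s defect k n"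
proof -
  let ?X = "sym_sum k n" and ?D = "defect k n" and ?\<epsilon> = "1 - 2 * \<phi>"
  let ?\<pi> = "proj n ?X"
  have D: "(2 * ?\<epsilon>) *s ?D = ?\<pi> - \<kappa> *s ?X - (2 * ?\<epsilon> * \<eta>) *s al n"
    by (simp add: proj_sym_sum algebra_simps)
  have "(2 * ?\<epsilon>) *s (?D \<cdot> ?X) = ?X \<cdot> ?\<pi> - \<kappa> *s (?X \<cdot> ?X) - (2 * ?\<epsilon> * \<eta>) *s (al n \<cdot> ?X)"
    using arg_cong[OF D, of "\<lambda>x. x \<cdot> ?X"] by (simp add: bilinear mult_commute)
  moreover have "(2 * ?\<epsilon>) *s (?D \<cdot> ?\<pi>) =
      ?\<pi> \<cdot> ?\<pi> - \<kappa> *s (?X \<cdot> ?\<pi>) - (2 * ?\<epsilon> * \<eta> * (1 - \<phi>)) *s ?\<pi>"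
    using arg_cong[OF D, of "\<lambda>x. x \<cdot> ?\<pi>"] by (simp add: bilinear axis.mult_even_proj sym_sum_even)
  moreover have "(2 * ?\<epsilon>) *s (?D \<cdot> ?D) =
      ?D \<cdot> ?\<pi> - \<kappa> *s (?D \<cdot> ?X) - (2 * ?\<epsilon> * \<eta>) *s (al n \<cdot> ?D)"
    using arg_cong[OF D, of "\<lambda>x. x \<cdot> ?D"] by (simp add: bilinear mult_commute)
  ultimately have "4 *s (?D \<cdot> ?D) =
      ?\<pi> \<cdot> ?\<pi> - \<kappa>\<^sup>2 *s (?X \<cdot> ?X) - (2 * ?\<epsilon> * \<kappa>) *s (2 *s (?D \<cdot> ?X))
      - (2 * ?\<epsilon> * \<kappa> * \<eta>) *s (al n \<cdot> ?X) - (2 * ?\<epsilon> * \<eta> * (1 - \<phi>)) *s ?\<pi>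
      - (2 * \<eta>) *s (2 *s (al n \<cdot> ?D))"
    using axis.\<phi>_cases
    by (intro coordinate_eqI)
      (elim coordinate_eqE disjE; hypsubst; unfold coordinate_simps; algebra)
  then show ?thesis
    using axis.\<phi>_cases
    unfolding sym_sum_square proj_sym_sum_square defect_mult_sym_sum mult_defect mult_sym_sum
    unfolding proj_sym_sum \<kappa>_def
    by (intro coordinate_eqI)
      (elim coordinate_eqE disjE; hypsubst; unfold coordinate_simps; algebra)
qed

definition p :: 'm where "p = defect 1 0"

abbreviation r :: "int \<Rightarrow> 'm" where "r \<equiv> defect 2"

lemma defect_1: "defect 1 n = p"
proof (induction n rule: int_induct[of _ 0])
  case base
  then show ?case by (simp add: p_def)
next
  case (step1 n)
  then show ?case using defect_add[of 1 n] by simp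
next
  case (step2 n)
  then show ?case using defect_minus[of 1 n] by simp
qed

lemmas mult_p = mult_defect[where k = 1, unfolded defect_1]
lemmas mult_r_add_1 = mult_defect_double[where k = 1, unfolded defect_1 int_shift_simps]
lemmas p_square = defect_square[where k = 1, unfolded defect_1 int_shift_simps]

lemma r_add_2: "r (n + 2) = r n" and r_minus_2: "r (n - 2) = r n"
  by (rule defect_add defect_minus)+

lemma r_minus_1: "r (n - 1) = r (n + 1)"
  using r_add_2[of "n - 1"] by (simp add: int_shift_simps)

lemma r_difference: "(2 * (1 + \<kappa>)) *s (r (n + 1) - r n) = (2 * \<eta> - 1) *s
   (\<kappa> *s (al (n - 2) + al n - al (n + 1) - al (n + 3)) + 2 *s (al (n + 2) - al (n - 1)))"
  (is "?lhs = ?rhs")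
proof (rule scale_left_imp_eq[OF \<kappa>_neq(1)])
  show "\<kappa> *s ?lhs = \<kappa> *s ?rhs"
    using trans[OF p_square[of n, symmetric] p_square[of "n + 1"]]
    unfolding sym_sum_def int_shift_simps r_add_2
    by (intro coordinate_eqI) (elim coordinate_eqE, unfold coordinate_simps, algebra)
qed

text \<open>
  \<open>H\<close> is the image of \<open>al\<close> under \<open>(1+x)(1-x\<^sup>3)\<close>, centred at \<open>n\<close>. Both \<open>r n\<close> and \<open>r (n + 1)\<close>
  multiply \<open>H n\<close> by a scalar, and as \<open>r\<close> has period 2, the recurrence for \<open>H\<close> relates these scalars.
\<close>

definition H :: "int \<Rightarrow> 'm" where
  "H n = al (n - 2) + al (n - 1) - al (n + 1) - al (n + 2)"

lemma H_recurrence: "\<kappa> *s (H (n - 1) + H (n + 1)) = 2 *s H n"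
proof (rule scale_left_imp_eq)
  show "2 * \<eta> - 1 \<noteq> 0" using \<eta>_neq_half by simp
  show "(2 * \<eta> - 1) *s (\<kappa> *s (H (n - 1) + H (n + 1))) = (2 * \<eta> - 1) *s (2 *s H n)"
    using r_difference[of n] r_difference[of "n - 1"]
    unfolding H_def int_shift_simps r_minus_1
    by (intro coordinate_eqI) (elim coordinate_eqE, unfold coordinate_simps, algebra)
qed

lemma r_mult_H: "2 *s (r n \<cdot> H n) =
    (\<kappa> * (1 - \<kappa>)) *s (H (n - 2) + H (n + 2)) + (\<kappa> * (2 * \<kappa> - 1)) *s (H (n - 1) + H (n + 1))
      + (2 * \<kappa> * (1 - 2 * \<kappa>) - 2 * \<eta>\<^sup>2) *s H n"
proof -
  have "2 *s (r n \<cdot> H n) = 2 *s (al (n - 2) \<cdot> r (n - 2)) + 2 *s (al (n - 1) \<cdot> r (n - 1 + 1))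
      - 2 *s (al (n + 1) \<cdot> r (n + 1 + 1)) - 2 *s (al (n + 2) \<cdot> r (n + 2))"
    by (simp add: int_shift_simps r_add_2 r_minus_2 H_def bilinear mult_commute[of "r _"]
        scale_right_distrib scale_right_diff_distrib)
  then show ?thesis
    using axis.\<phi>_cases r_add_2[of "n + 1"]
    unfolding mult_defect mult_r_add_1 sym_sum_def
    unfolding H_def int_shift_simps r_add_2 r_minus_2 r_minus_1 \<kappa>_def
    by (intro coordinate_eqI)
      (elim coordinate_eqE disjE; hypsubst; unfold coordinate_simps; algebra)
qed

lemma r_add_1_mult_H: "2 *s (r (n + 1) \<cdot> H n) =
    \<kappa>\<^sup>2 *s (H (n - 2) + H (n + 2)) + (2 * \<kappa> * (1 - 2 * \<kappa>)) *s (H (n - 1) + H (n + 1))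
      + (2 * \<kappa> * (2 * \<kappa> - 1) - 2 * \<eta>\<^sup>2) *s H n"
proof -
  have "2 *s (r (n + 1) \<cdot> H n) = 2 *s (al (n - 2) \<cdot> r (n - 2 + 1)) + 2 *s (al (n - 1) \<cdot> r (n - 1))
      - 2 *s (al (n + 1) \<cdot> r (n + 1)) - 2 *s (al (n + 2) \<cdot> r (n + 2 + 1))"
    using r_add_2[of "n + 1"]
    by (simp add: int_shift_simps r_minus_1 H_def bilinear mult_commute[of "r _"]
        scale_right_distrib scale_right_diff_distrib)
  then show ?thesis
    using axis.\<phi>_cases r_add_2[of "n + 1"]
    unfolding mult_defect mult_r_add_1 sym_sum_def
    unfolding H_def int_shift_simps r_add_2 r_minus_2 r_minus_1 \<kappa>_def
    by (intro coordinate_eqI)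
      (elim coordinate_eqE disjE; hypsubst; unfold coordinate_simps; algebra)
qed

lemma H_recurrence_2: "\<kappa>\<^sup>2 *s (H (n - 2) + H (n + 2)) = (4 - 2 * \<kappa>\<^sup>2) *s H n"
  using H_recurrence[of n] H_recurrence[of "n - 1"] H_recurrence[of "n + 1"]
  unfolding int_shift_simps
  by (intro coordinate_eqI) (elim coordinate_eqE, unfold coordinate_simps, algebra)

lemma r_eigenvector_H:
  "(2 * \<kappa>) *s (r n \<cdot> H n) = (4 - 6 * \<kappa> + 4 * \<kappa>\<^sup>2 - 2 * \<kappa>^3 - 2 * \<kappa> * \<eta>\<^sup>2) *s H n"
  using r_mult_H[of n] H_recurrence[of n] H_recurrence_2[of n]
  by (intro coordinate_eqI) (elim coordinate_eqE, unfold coordinate_simps, algebra)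

lemma r_add_1_eigenvector_H:
  "2 *s (r (n + 1) \<cdot> H n) = (8 - 10 * \<kappa> + 2 * \<kappa>\<^sup>2 - 2 * \<eta>\<^sup>2) *s H n"
  using r_add_1_mult_H[of n] H_recurrence[of n] H_recurrence_2[of n]
  by (intro coordinate_eqI) (elim coordinate_eqE, unfold coordinate_simps, algebra)

lemma H_zero_or_\<kappa>_eq_2: "H n = 0 \<or> \<kappa> = 2"
proof -
  have "r n \<cdot> (\<kappa> *s (H (n - 1) + H (n + 1))) = r n \<cdot> (2 *s H n)"
    by (simp only: H_recurrence)
  then have "(2 * 2 * (\<kappa> - 1) * (2 * \<kappa> - 1) * (\<kappa> - 2)) *s H n = 0"
    using r_eigenvector_H[of n] r_add_1_eigenvector_H[of "n - 1"] r_add_1_eigenvector_H[of "n + 1"]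
      H_recurrence[of n]
    unfolding int_shift_simps r_add_2 bilinear
    by (intro coordinate_eqI) (elim coordinate_eqE, unfold coordinate_simps, algebra)
  then show ?thesis using \<kappa>_neq four_neq_0 by auto
qed

text \<open>For \<open>\<kappa> = 2\<close> the two ways of computing \<open>al n \<cdot> al (n + 3)\<close> have to be compared instead.\<close>

lemma mult_H_diff: "al n \<cdot> (H (n - 1) - H (n + 1)) = \<phi> *s (H (n - 1) - H (n + 1))"
proof -
  let ?X = "sym_sum 1 n" and ?Y = "sym_sum 2 n" and ?Z = "sym_sum 3 n"
  have "(4 * (1 + \<kappa>)) *s (r (n + 1) - r n) =
      (2 * \<eta> - 1) *s (\<kappa> *s (2 *s al n - ?X + ?Y - ?Z) + 2 *s (?Y - ?X))"
    using r_difference[of n] r_difference[of "n - 1"]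
    unfolding sym_sum_def int_shift_simps r_minus_1
    by (intro coordinate_eqI) (elim coordinate_eqE, unfold coordinate_simps, algebra)
  note arg_cong[OF this, of "proj n", unfolded even_proj_linear]
  moreover have "2 *s (proj n (r (n + 1)) - proj n (r n)) = (2 * \<eta> - 1) *s (proj n ?Y - proj n ?X)"
    using proj_defect_double[of n 1] proj_defect[of n 2] axis.\<phi>_cases
    unfolding int_shift_simps \<kappa>_def
    by (intro coordinate_eqI)
      (elim coordinate_eqE disjE; hypsubst; unfold coordinate_simps; algebra)
  ultimately have
    "((2 * \<eta> - 1) * \<kappa>) *s (proj n ?Z + proj n ?Y - proj n ?X - 2 *s proj n (al n)) = 0"
    by (intro coordinate_eqI) (elim coordinate_eqE, unfold coordinate_simps, algebra)
  then have "proj n (?Z + ?Y - ?X - 2 *s al n) = 0"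
    using \<kappa>_neq \<eta>_neq_half by (simp add: even_proj_linear)
  moreover have "H (n - 1) - H (n + 1) = ?Z + ?Y - ?X - 2 *s al n"
    unfolding H_def sym_sum_def int_shift_simps
    by (rule coordinate_eqI, unfold coordinate_simps, algebra)
  ultimately show ?thesis
    using axis.\<phi>_cases by (auto simp: even_proj_def)
qed

lemma mult_H_sum: "al n \<cdot> (H (n - 1) + H (n + 1)) = \<eta> *s (H (n - 1) + H (n + 1))"
proof -
  have "H (n - 1) + H (n + 1) =
      - ((al (n + 1) - al (n - 1)) + (al (n + 2) - al (n - 2)) + (al (n + 3) - al (n - 3)))"
    by (simp add: H_def int_shift_simps)
  then show ?thesis
    by (simp only: mult_minus_right mult_add_right mult_al_diff)
      (simp add: scale_right_distrib scale_right_diff_distrib)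
qed

lemma mult_H_add_1: "2 *s (al n \<cdot> H (n + 1)) = (\<eta> + \<phi>) *s H (n + 1) + (\<eta> - \<phi>) *s H (n - 1)"
  using mult_H_sum[of n] mult_H_diff[of n] unfolding bilinear
  by (intro coordinate_eqI) (elim coordinate_eqE, unfold coordinate_simps, algebra)

lemma mult_H_minus_1: "2 *s (al n \<cdot> H (n - 1)) = (\<eta> + \<phi>) *s H (n - 1) + (\<eta> - \<phi>) *s H (n + 1)"
  using mult_H_sum[of n] mult_H_diff[of n] unfolding bilinear
  by (intro coordinate_eqI) (elim coordinate_eqE, unfold coordinate_simps, algebra)

lemma r_difference_from_ends: "2 *s (r (n + 1) - r n) = 2 *s (al (n + 3) - al n)
    + (2 * \<eta>) *s (al (n + 4) - al (n + 1) + al (n + 2) - al (n - 1))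
    + (\<eta> + \<phi>) *s (H (n + 1) + H (n + 2)) + (\<eta> - \<phi>) *s (H (n - 1) + H (n + 4))"
proof -
  have "al n \<cdot> al (n + 3) = al n + p - r n + \<eta> *s (al (n - 1) - al (n + 2)) - al n \<cdot> H (n + 1)"
    unfolding H_def[of "n + 1"] bilinear int_shift_simps mult_al_add mult_al_minus axis.idem
      defect_1
    by (rule coordinate_eqI, unfold coordinate_simps, algebra)
  moreover have "al (n + 3) \<cdot> al n = al (n + 3) + p - r (n + 3) + \<eta> *s (al (n + 4) - al (n + 1))
      + al (n + 3) \<cdot> H (n + 2)"
    using mult_al_add[of "n + 3" 1] mult_al_minus[of "n + 3" 2]
    unfolding H_def[of "n + 2"] bilinear int_shift_simps axis.idem defect_1
    by (intro coordinate_eqI) (elim coordinate_eqE, unfold coordinate_simps, algebra)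
  ultimately show ?thesis
    using mult_H_add_1[of n] mult_H_minus_1[of "n + 3"] r_add_2[of "n + 1"]
    unfolding int_shift_simps mult_commute[of "al (n + 3)" "al n"]
    by (intro coordinate_eqI) (elim coordinate_eqE, unfold coordinate_simps, algebra)
qed

lemma scaled_H_sum_eq_0: "(4 + 2 * \<kappa> - 5 * \<kappa>\<^sup>2) *s (H (n + 1) + H (n + 2)) = 0"
proof -
  let ?S = "H (n + 1) + H (n + 2)" and ?T = "H (n - 1) + H (n + 4)"
  define \<rho> where "\<rho> = r (n + 1) - r n - (2 * \<eta> - 1) *s (al (n + 2) - al (n - 1))"
  have "(2 * (1 + \<kappa>)) *s \<rho> = ((2 * \<eta> - 1) * \<kappa>) *s (H n + H (n + 1))"
    using r_difference[of n] unfolding H_def int_shift_simps \<rho>_def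
    by (intro coordinate_eqI) (elim coordinate_eqE, unfold coordinate_simps, algebra)
  moreover have "\<kappa> *s (H n + H (n + 1)) = (1 + \<kappa>) *s (H (n + 1) - H (n + 2)) + ?S"
    using H_recurrence[of "n + 1"] unfolding int_shift_simps
    by (intro coordinate_eqI) (elim coordinate_eqE, unfold coordinate_simps, algebra)
  moreover have "2 *s \<rho> = (2 * (\<eta> - 1)) *s H (n + 1) - (2 * \<eta>) *s H (n + 2)
      + (\<eta> + \<phi>) *s ?S + (\<eta> - \<phi>) *s ?T"
    using r_difference_from_ends[of n] unfolding H_def int_shift_simps \<rho>_def
    by (intro coordinate_eqI) (elim coordinate_eqE, unfold coordinate_simps, algebra)
  ultimately have "(1 + \<kappa>) *s ((\<eta> + \<phi> - 1) *s ?S + (\<eta> - \<phi>) *s ?T) = (2 * \<eta> - 1) *s ?S"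
    by (intro coordinate_eqI) (elim coordinate_eqE, unfold coordinate_simps, algebra)
  moreover have "\<eta> + \<phi> - 1 = (1 - 2 * \<phi>) * (\<kappa> - 1)" "\<eta> - \<phi> = (1 - 2 * \<phi>) * \<kappa>"
    "2 * \<eta> - 1 = (1 - 2 * \<phi>) * (2 * \<kappa> - 1)" "(1 - 2 * \<phi>)\<^sup>2 = 1"
    using axis.\<phi>_cases by (auto simp: \<kappa>_def)
  moreover from this(4) have "1 - 2 * \<phi> \<noteq> 0" by (metis zero_neq_one zero_power2)
  ultimately have "(1 + \<kappa>) *s ((\<kappa> - 1) *s ?S + \<kappa> *s ?T) = (2 * \<kappa> - 1) *s ?S"
    by (simp flip: scale_scale scale_right_distrib add: scale_left_commute[of _ "1 - 2 * \<phi>"])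
  moreover have "\<kappa>\<^sup>2 *s ?T = (4 - 2 * \<kappa> - \<kappa>\<^sup>2) *s ?S"
    using H_recurrence[of n] H_recurrence[of "n + 1"] H_recurrence[of "n + 2"]
      H_recurrence[of "n + 3"]
    unfolding int_shift_simps
    by (intro coordinate_eqI) (elim coordinate_eqE, unfold coordinate_simps, algebra)
  ultimately have "\<kappa> *s (4 + 2 * \<kappa> - 5 * \<kappa>\<^sup>2) *s ?S = \<kappa> *s 0"
    by (intro coordinate_eqI) (elim coordinate_eqE, unfold coordinate_simps, algebra)
  then show ?thesis by (rule scale_left_imp_eq[OF \<kappa>_neq(1)])
qed

lemma H_zero: "H n = 0"
proof (cases "\<kappa> = 2")
  case True
  have "(2 * \<kappa> :: 'f) = 3 + 1" by (simp add: True)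
  then have three: "(3::'f) \<noteq> 0" using \<kappa>_neq(3) by (metis add_0)
  have "4 + 2 * \<kappa> - 5 * \<kappa>\<^sup>2 = - (4 * 3)" by (simp add: True)
  then have "H (m + 1) + H (m + 2) = 0" for m
    using scaled_H_sum_eq_0[of m] three four_neq_0
    by (metis mult_eq_0_iff neg_equal_0_iff_equal scale_eq_0_iff)
  from this[of "n - 1"] this[of "n - 2"] have "(2 * 3) *s H n = 0"
    using H_recurrence[of n] unfolding True int_shift_simps
    by (intro coordinate_eqI) (elim coordinate_eqE, unfold coordinate_simps, algebra)
  then show ?thesis using two_neq_0 three by (metis mult_eq_0_iff scale_eq_0_iff)
qed (use H_zero_or_\<kappa>_eq_2 in auto)

end

section \<open>The algebra \<open>3C\<close> with a hat\<close>

lemma distinct_UNIV_3: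
  fixes i j k :: 3
  assumes "distinct [i, j, k]"
  shows "UNIV = {i, j, k}"
  using assms by (intro card_subset_eq[symmetric]) simp_all

lemma UNIV_3: "(UNIV :: 3 set) = {0, 1, -1}"
  by (rule distinct_UNIV_3) simp

lemma sum_distinct_3:
  fixes i j k :: 3
  assumes "distinct [i, j, k]"
  shows "(\<Sum>l\<in>UNIV. f l) = f i + f j + (f k :: 'a::comm_monoid_add)"
  using assms by (simp add: distinct_UNIV_3[OF assms] add.assoc)

lemma obtain_third_3:
  fixes i j :: 3
  assumes "i \<noteq> j"
  obtains k where "distinct [i, j, k]"
proof -
  have "card {i, j} < card (UNIV :: 3 set)" using assms by simp
  then have "{i, j} \<noteq> UNIV" by (metis less_irrefl)
  then show ?thesis using that assms by fastforce
qed

locale hat_3C_relations = comm_algebra scale mult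
  for scale :: "'f::field \<Rightarrow> 'm::ab_group_add \<Rightarrow> 'm" (infixr \<open>*s\<close> 75)
    and mult :: "'m \<Rightarrow> 'm \<Rightarrow> 'm" (infixl \<open>\<cdot>\<close> 70) +
  fixes \<eta> :: 'f and A :: "3 \<Rightarrow> 'm" and q s0 s1 :: 'm
  assumes two_neq_0: "(2::'f) \<noteq> 0" and \<eta>_neq_0: "\<eta> \<noteq> 0" and \<eta>_neq_1: "\<eta> \<noteq> 1"
    and A_idem: "A i \<cdot> A i = A i"
    and A_mult: "distinct [i, j, k] \<Longrightarrow>
      2 *s (A i \<cdot> A j) = (\<eta> + 1) *s (A i + A j) + (1 - \<eta>) *s A k - q"
    and q_mult_A: "q \<cdot> A i = (\<eta> + 1) *s A i" and q_square: "q \<cdot> q = (\<eta> + 1) *s q"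
    and s0_idem: "s0 \<cdot> s0 = s0" and s1_idem: "s1 \<cdot> s1 = s1" and s0_mult_s1: "s0 \<cdot> s1 = 0"
    and s0_mult_A: "s0 \<cdot> A i = 0" and s1_mult_A: "s1 \<cdot> A i = 0"
    and s0_mult_q: "s0 \<cdot> q = 0" and s1_mult_q: "s1 \<cdot> q = 0"

context axis_sequence
begin

definition \<delta> :: "int \<Rightarrow> 'm" where "\<delta> n = al (n + 2) - al (n - 1)"
definition s :: "int \<Rightarrow> 'm" where "s n = al n \<cdot> \<delta> n"
definition A :: "int \<Rightarrow> 'm" where "A n = al n - s n"

lemma \<delta>_add_1: "\<delta> (n + 1) = - \<delta> n"
  using H_zero[of "n + 1"] unfolding H_def \<delta>_def int_shift_simps by (simp add: algebra_simps)

lemma \<delta>_add_2: "\<delta> (n + 2) = \<delta> n"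
  using \<delta>_add_1[of n] \<delta>_add_1[of "n + 1"] by (simp add: int_shift_simps)

lemma \<delta>_minus_1: "\<delta> (n - 1) = - \<delta> n"
  using \<delta>_add_1[of "n - 1"] by simp

lemma r_add_1: "r (n + 1) = r n + (2 * \<eta> - 1) *s \<delta> n"
proof (rule scale_left_imp_eq[OF two_neq_0])
  show "2 *s r (n + 1) = 2 *s (r n + (2 * \<eta> - 1) *s \<delta> n)"
    using r_difference_from_ends[of n] \<delta>_add_1[of n] \<delta>_add_2[of n]
    unfolding H_zero \<delta>_def int_shift_simps
    by (intro coordinate_eqI) (elim coordinate_eqE, unfold coordinate_simps, algebra)
qed

lemma s_eq: "s n = r n - p + \<eta> *s \<delta> n"
  unfolding s_def \<delta>_def bilinear mult_al_add mult_al_minus defect_1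
  by (rule coordinate_eqI, unfold coordinate_simps, algebra)

lemma s_diff: "s n - s (n + 1) = \<delta> n"
  using \<delta>_add_1[of n] unfolding s_eq r_add_1
  by (intro coordinate_eqI) (elim coordinate_eqE, unfold coordinate_simps, algebra)

lemma r_eq: "r n = p + s n - \<eta> *s (s n - s (n + 1))"
  by (simp add: s_diff) (simp add: s_eq)

lemma s_add_2: "s (n + 2) = s n"
  by (simp add: s_eq \<delta>_add_2 r_add_2)

lemma s_minus_1: "s (n - 1) = s (n + 1)"
  using s_add_2[of "n - 1"] by (simp add: int_shift_simps)

lemma s_cong: "even (m - n) \<Longrightarrow> s m = s n"
proof -
  have "s (n + 2 * k) = s n" for k :: int
  proof (induction k rule: int_induct[of _ 0])
    case (step1 k)
    then show ?case using s_add_2[of "n + 2 * k"] by (simp add: algebra_simps)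
  next
    case (step2 k)
    then show ?case using s_add_2[of "n + 2 * (k - 1)"] by (simp add: algebra_simps)
  qed simp
  moreover assume "even (m - n)"
  then obtain k where "m = n + 2 * k" by (metis evenE diff_add_cancel add.commute)
  ultimately show ?thesis by simp
qed

lemma parity_cases:
  obtains "even (m - n)" "s m = s n" | "odd (m - n)" "s m = s (n + 1)"
  using s_cong[of m n] s_cong[of m "n + 1"] that by fastforce

lemma al_mult_s: "al n \<cdot> s m = (if even (m - n) then s m else 0)"
proof -
  have same: "al n \<cdot> s n = s n"
  proof (rule scale_left_imp_eq[OF two_neq_0])
    have "\<delta> n - \<delta> (n - 1) = sym_sum 2 n - sym_sum 1 n"
      by (simp add: \<delta>_def sym_sum_def int_shift_simps)
    then show "2 *s (al n \<cdot> s n) = 2 *s s n"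
      using mult_defect[of n 2] mult_p[of n] s_eq[of n] \<delta>_minus_1[of n]
        arg_cong[OF s_eq[of n], of "mult (al n)", unfolded bilinear s_def[symmetric]]
      by (intro coordinate_eqI) (elim coordinate_eqE, unfold coordinate_simps, algebra)
  qed
  moreover have "al n \<cdot> s (n + 1) = 0"
    using arg_cong[OF s_diff[of n], of "mult (al n)"] same by (simp add: bilinear s_def[of n])
  ultimately show ?thesis by (cases rule: parity_cases[of m n]) simp_all
qed

lemma proj_s: "proj n (s m) = (if even (m - n) then 1 - \<phi> else \<phi>) *s s m"
  by (simp add: even_proj_def al_mult_s algebra_simps flip: scale_left_distrib)

lemma s_even: "axis_even (al n) (s m)"
  by (simp add: axis_even_def al_mult_s)

lemma axis_fixing_s:
  obtains n where "proj n (s m) = s m" "proj n (s (m + 1)) = 0"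
    "al n \<cdot> s m = (1 - \<phi>) *s s m"
    "sym_sum 1 n \<cdot> s m = (2 * \<phi>) *s s m"
proof -
  define n where "n = (if \<phi> = 0 then m else m + 1)"
  have "proj n (s m) = s m" "proj n (s (m + 1)) = 0" "al n \<cdot> s m = (1 - \<phi>) *s s m"
    "sym_sum 1 n \<cdot> s m = (2 * \<phi>) *s s m"
    using axis.\<phi>_cases scale_left_distrib[of 1 1 "s m"]
    by (auto simp: n_def proj_s al_mult_s sym_sum_def bilinear)
  then show ?thesis by (rule that)
qed

lemma s_square_and_s_mult_next: "s m \<cdot> s m = s m \<and> s m \<cdot> s (m + 1) = 0"
proof -
  have "\<delta> m \<cdot> s m = s m" by (simp add: \<delta>_def bilinear al_mult_s)
  then have square: "s m \<cdot> s m = s m + s m \<cdot> s (m + 1)"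
    by (simp add: bilinear mult_commute algebra_simps flip: s_diff)
  obtain n where "proj n (s m) = s m" "proj n (s (m + 1)) = 0"
    by (rule axis_fixing_s)
  then have "s m \<cdot> s m = s m"
    using arg_cong[OF square, of "proj n"]
    by (simp add: even_proj_linear axis.even_proj_mult s_even)
  with square show ?thesis by simp
qed

lemma s_mult_s: "s n \<cdot> s m = (if even (m - n) then s n else 0)"
  using s_square_and_s_mult_next[of n] by (cases rule: parity_cases[of m n]) simp_all

lemma p_mult_s: "p \<cdot> s m = - (\<eta> *s s m)"
proof -
  obtain n where n: "proj n (s m) = s m"
    "al n \<cdot> s m = (1 - \<phi>) *s s m"
    "sym_sum 1 n \<cdot> s m = (2 * \<phi>) *s s m"
    by (rule axis_fixing_s)
  have "proj n (sym_sum 1 n \<cdot> s m) = proj n (sym_sum 1 n) \<cdot> s m"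
    by (simp add: axis.even_proj_mult sym_sum_even s_even n(1))
  also have "\<dots> = (2 * \<kappa> * \<phi>) *s s m
      + (2 * (1 - 2 * \<phi>)) *s (p \<cdot> s m + (\<eta> * (1 - \<phi>)) *s s m)"
    by (simp add: proj_sym_sum defect_1 bilinear n)
  finally have "2 *s (p \<cdot> s m) = 2 *s (- (\<eta> *s s m))"
    using axis.\<phi>_cases unfolding n even_proj_linear \<kappa>_def
    by (intro coordinate_eqI)
      (elim coordinate_eqE disjE; hypsubst; unfold coordinate_simps; algebra)
  then show ?thesis by (rule scale_left_imp_eq[OF two_neq_0])
qed

definition P :: 'm where "P = p + \<eta> *s (s 0 + s 1)"

lemma A_mult_s: "A n \<cdot> s m = 0"
  by (cases rule: parity_cases[of m n]) (simp_all add: A_def bilinear al_mult_s s_mult_s)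

lemma P_eq: "P = p + \<eta> *s (s n + s (n + 1))"
proof (induction n rule: int_induct[of _ 0])
  case (step1 n)
  then show ?case using s_add_2[of n] by (simp add: int_shift_simps add.commute)
next
  case (step2 n)
  then show ?case by (simp add: s_minus_1 add.commute)
qed (simp add: P_def)

lemma P_mult_s: "P \<cdot> s n = 0"
  by (simp add: P_eq[of n] bilinear s_mult_s p_mult_s)

lemma A_add_3: "A (n + 3) = A n"
proof -
  have "al (n + 3) = al n + \<delta> (n + 1)" by (simp add: \<delta>_def int_shift_simps)
  also have "\<dots> = al n - (s n - s (n + 1))" by (simp add: \<delta>_add_1 s_diff)
  finally show ?thesis using s_add_2[of "n + 1"] by (simp add: A_def int_shift_simps)
qed

lemma A_square: "A n \<cdot> A n = A n"
  by (simp add: A_def bilinear axis.idem al_mult_s s_mult_s mult_commute[of "s n" "al n"])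

lemma A_mult_A: "A n \<cdot> A (n + 1) = P + \<eta> *s (A n + A (n + 1))"
  unfolding P_eq[of n] A_def bilinear mult_al_add defect_1 mult_commute[of "s n" "al (n + 1)"]
  by (simp add: al_mult_s s_mult_s algebra_simps)

definition A_sum :: 'm where "A_sum = A (- 1) + A 0 + A 1"

lemma A_sum_eq: "A_sum = A (n - 1) + A n + A (n + 1)"
proof (induction n rule: int_induct[of _ 0])
  case (step1 n)
  then show ?case using A_add_3[of "n - 1"] by (simp add: int_shift_simps add_ac)
next
  case (step2 n)
  then show ?case using A_add_3[of "n - 2"] by (simp add: int_shift_simps add_ac)
qed (simp add: A_sum_def)

lemma A_mult_A_sum: "A n \<cdot> A_sum = 2 *s P + \<eta> *s A_sum + (\<eta> + 1) *s A n"
proof -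
  have "A n \<cdot> A_sum = A (n - 1) \<cdot> A (n - 1 + 1) + A n \<cdot> A n + A n \<cdot> A (n + 1)"
    by (simp add: A_sum_eq[of n] bilinear mult_commute[of "A n" "A (n - 1)"])
  then show ?thesis
    unfolding A_mult_A A_square unfolding A_sum_eq[of n] int_shift_simps
    by (intro coordinate_eqI) (elim coordinate_eqE, unfold coordinate_simps, algebra)
qed

lemma P_mult_A: "2 *s (P \<cdot> A n) =
    (2 * (1 - \<eta>)) *s P + (\<eta> * (1 - \<eta>)) *s A_sum - (\<eta> * (\<eta> + 1)) *s A n"
proof -
  have "P \<cdot> A n = P \<cdot> al n" by (simp add: A_def bilinear P_mult_s)
  also have "\<dots> = al n \<cdot> p + \<eta> *s s n"
    unfolding P_eq[of n] mult_commute[of _ "al n"] by (simp add: bilinear al_mult_s)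
  finally have "2 *s (P \<cdot> A n) = 2 *s (al n \<cdot> p) + (2 * \<eta>) *s s n"
    by (simp add: scale_right_distrib)
  moreover have "sym_sum 1 n = A (n - 1) + A (n + 1) + 2 *s s (n + 1)"
    unfolding sym_sum_def A_def s_minus_1
    by (rule coordinate_eqI, unfold coordinate_simps, algebra)
  ultimately show ?thesis
    unfolding mult_p A_sum_eq[of n] P_eq[of n] A_def[of n]
    by (intro coordinate_eqI) (elim coordinate_eqE, unfold coordinate_simps, algebra)
qed

lemma P_square: "4 *s (P \<cdot> P) =
    (2 * \<eta> * (1 - \<eta>) * (1 - 2 * \<eta>)) *s A_sum + (2 * (1 - 3 * \<eta>) * (2 - \<eta>)) *s P"
proof -
  have indices: "A 2 = A (- 1)" "A (- 2) = A 1" "s (- 1) = s 1" "s 2 = s 0" "s (- 2) = s 0"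
    using A_add_3[of "- 1"] A_add_3[of "- 2"] s_add_2[of "- 1"] s_add_2[of "- 2"] s_add_2[of 0]
    by simp_all
  have al: "al n = A n + s n" for n by (simp add: A_def)
  have terms: "al 0 = A 0 + s 0" "sym_sum 1 0 = A 1 + s 1 + (A (- 1) + s 1)"
    "sym_sum 2 0 = A (- 1) + s 0 + (A 1 + s 0)" "r 0 = p + s 0 - \<eta> *s (s 0 - s 1)"
    "r (0 + 1) = p + s 1 - \<eta> *s (s 1 - s 0)"
    using r_eq[of 0] r_eq[of 1] al[of 1] al[of 2] al[of "- 1"] al[of "- 2"]
    by (simp_all add: al[of 0] sym_sum_def indices)
  have "P \<cdot> P = P \<cdot> p"
    by (subst (2) P_def) (simp add: bilinear P_mult_s)
  also have "\<dots> = p \<cdot> p - \<eta>\<^sup>2 *s (s 0 + s 1)"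
    by (simp add: P_def bilinear mult_commute[of "s _" p] p_mult_s algebra_simps power2_eq_square)
  finally have "4 *s (P \<cdot> P) = 4 *s (p \<cdot> p) - (4 * \<eta>\<^sup>2) *s (s 0 + s 1)"
    by (simp add: scale_right_diff_distrib)
  also have "\<dots> = (2 * \<eta> * (1 - \<eta>) * (1 - 2 * \<eta>)) *s A_sum + (2 * (1 - 3 * \<eta>) * (2 - \<eta>)) *s P"
    using axis.\<phi>_cases
    unfolding p_square[of 0] terms unfolding A_sum_def P_def \<kappa>_def
    by (intro coordinate_eqI)
      (elim disjE; hypsubst; simp add: coordinate_simps algebra_simps power2_eq_square)
  finally show ?thesis .
qed

definition q :: 'm where "q = (1 - \<eta>) *s A_sum - 2 *s P"

lemma q_mult_A: "q \<cdot> A n = (\<eta> + 1) *s A n"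
proof -
  have "q \<cdot> A n = (1 - \<eta>) *s (A n \<cdot> A_sum) - 2 *s (P \<cdot> A n)"
    by (simp add: q_def bilinear mult_commute[of A_sum])
  also have "\<dots> = (\<eta> + 1) *s A n"
    unfolding A_mult_A_sum P_mult_A
    by (rule coordinate_eqI, unfold coordinate_simps, algebra)
  finally show ?thesis .
qed

lemma q_mult_A_sum: "q \<cdot> A_sum = (\<eta> + 1) *s A_sum"
  by (simp add: A_sum_def bilinear q_mult_A scale_right_distrib)

lemma q_square: "q \<cdot> q = (\<eta> + 1) *s q"
proof (rule scale_left_imp_eq[OF two_neq_0])
  have "2 *s (P \<cdot> A_sum) = 2 *s (P \<cdot> A (- 1)) + 2 *s (P \<cdot> A 0) + 2 *s (P \<cdot> A 1)"
    by (simp add: A_sum_def bilinear scale_right_distrib)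
  also have "\<dots> = (6 * (1 - \<eta>)) *s P + (2 * \<eta> * (1 - 2 * \<eta>)) *s A_sum"
    unfolding P_mult_A A_sum_def
    by (rule coordinate_eqI, unfold coordinate_simps, algebra)
  finally have P_mult_A_sum: "2 *s (P \<cdot> A_sum) = \<dots>" .
  have "4 *s (q \<cdot> P) = (2 * (1 - \<eta>)) *s (2 *s (P \<cdot> A_sum)) - 2 *s (4 *s (P \<cdot> P))"
    by (simp add: q_def bilinear mult_commute[of A_sum] scale_right_diff_distrib)
  also have "\<dots> = (4 * (\<eta> + 1)) *s P"
    unfolding P_mult_A_sum P_square
    by (rule coordinate_eqI, unfold coordinate_simps, algebra)
  finally have "4 *s (q \<cdot> P) = \<dots>" .
  moreover have "q \<cdot> q = (1 - \<eta>) *s (q \<cdot> A_sum) - 2 *s (q \<cdot> P)"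
    by (subst (2) q_def) (simp add: bilinear)
  ultimately show "2 *s (q \<cdot> q) = 2 *s (\<eta> + 1) *s q"
    using q_def unfolding q_mult_A_sum
    by (intro coordinate_eqI) (elim coordinate_eqE, unfold coordinate_simps, algebra)
qed

lemma q_mult_s: "s n \<cdot> q = 0"
  by (simp add: q_def A_sum_def bilinear mult_commute[of "s n"] A_mult_s P_mult_s)

definition axis_3 :: "3 \<Rightarrow> 'm" where
  "axis_3 i = A (if i = 0 then 0 else if i = 1 then 1 else - 1)"

lemma axis_3_mult:
  assumes "distinct [i, j, k]"
  shows "2 *s (axis_3 i \<cdot> axis_3 j) =
    (\<eta> + 1) *s (axis_3 i + axis_3 j) + (1 - \<eta>) *s axis_3 k - q"
proof -
  have products: "A 0 \<cdot> A 1 = P + \<eta> *s (A 0 + A 1)"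
    "A 1 \<cdot> A (- 1) = P + \<eta> *s (A 1 + A (- 1))" "A (- 1) \<cdot> A 0 = P + \<eta> *s (A (- 1) + A 0)"
    using A_mult_A[of 0] A_mult_A[of 1] A_mult_A[of "- 1"] A_add_3[of "- 1"] by simp_all
  have "i = 0 \<or> i = 1 \<or> i = -1" "j = 0 \<or> j = 1 \<or> j = -1"
    using UNIV_3 by blast+
  with assms have "axis_3 i \<cdot> axis_3 j = P + \<eta> *s (axis_3 i + axis_3 j)"
    using products mult_commute[of "A 0" "A 1"] mult_commute[of "A 0" "A (- 1)"]
      mult_commute[of "A 1" "A (- 1)"]
    by (auto simp: axis_3_def add.commute)
  moreover have "A_sum = axis_3 i + axis_3 j + axis_3 k"
    using sum_distinct_3[OF assms, of axis_3] sum_distinct_3[of 0 1 "-1" axis_3]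
    by (simp add: axis_3_def A_sum_def add_ac)
  ultimately show ?thesis
    unfolding q_def
    by (intro coordinate_eqI) (elim coordinate_eqE, unfold coordinate_simps, algebra)
qed

lemma hat_3C_relations_axis_3:
  "hat_3C_relations scale mult \<eta> axis_3 q (s 0) (s 1)"
  using axis.\<eta>_neq_0 axis.\<eta>_neq_1 two_neq_0
  by unfold_locales
    (auto simp: axis_3_mult, auto simp: axis_3_def A_square A_mult_s q_mult_A q_square q_mult_s
      s_mult_s mult_commute[of "s _" "A _"])

end

lemma (in comm_algebra) hat_3C_relations_if_axes:
  assumes axes: "axis \<Phi> \<eta> a" "axis \<Phi> \<eta> b"
    and \<Phi>: "\<Phi> \<subseteq> {0, 1}" "\<Phi> \<noteq> {0, 1}"
    and neq: "(2::'f) \<noteq> 0" "\<eta> \<noteq> 0" "\<eta> \<noteq> 1" "2 * \<eta> \<noteq> 1"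
  obtains A q s0 s1 where "a = A 0 + s0" "b = A 1 + s1" "hat_3C_relations scale mult \<eta> A q s0 s1"
proof -
  note graded = graded_axis_if_axis[OF _ \<Phi> neq(2,3)]
  obtain al where al: "axis_sequence scale mult (if \<Phi> = {1} then 1 else 0) \<eta> al"
      "al 0 = a" "al 1 = b"
    by (rule axis_sequence_exists[OF graded[OF axes(1)] graded[OF axes(2)] neq(1,4)]) (rule that)
  interpret axis_sequence scale mult "if \<Phi> = {1} then 1 else 0" \<eta> al
    by (rule al)
  show ?thesis
    by (rule that[OF _ _ hat_3C_relations_axis_3]) (simp_all add: axis_3_def A_def al)
qed

section \<open>Homomorphisms from concrete algebras\<close>

context comm_algebra
begin

definition alg_hom :: "('f, 'a) alg \<Rightarrow> ('a \<Rightarrow> 'm) \<Rightarrow> bool" where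
  "alg_hom A g \<longleftrightarrow> carrier A = UNIV \<and> (\<forall>x y. g (add A x y) = g x + g y) \<and>
    (\<forall>c x. g (smult A c x) = c *s g x) \<and> (\<forall>x y. g (alg.mult A x y) = g x \<cdot> g y)"

lemma alg_homD:
  assumes "alg_hom A g"
  shows "carrier A = UNIV" "g (add A x y) = g x + g y" "g (smult A c x) = c *s g x"
    "g (alg.mult A x y) = g x \<cdot> g y"
  using assms by (auto simp: alg_hom_def)

lemma surj_alg_hom:
  assumes g: "alg_hom A g" and generates: "subalgebra hull (g ` S) = UNIV"
  shows "surj g"
proof -
  note hom = alg_homD[OF g]
  have "subalgebra (range g)"
    unfolding subalgebra_def subspace_def
  proof (intro conjI ballI allI)
    show "0 \<in> range g" using hom(3)[of 0] by (metis rangeI scale_zero_left)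
  qed (use hom in \<open>auto simp: image_iff; metis\<close>)+
  then have "subalgebra hull (g ` S) \<subseteq> range g" by (intro hull_minimal) auto
  with generates show ?thesis by auto
qed

lemma isomorphic_if_same_kernel:
  assumes g: "alg_hom A g" and generates: "subalgebra hull (g ` S) = UNIV"
    and kernel: "\<And>x y. g x = g y \<longleftrightarrow> h x = h y"
    and range: "range h = carrier B"
    and hom: "\<And>x y. h (add A x y) = add B (h x) (h y)" "\<And>c x. h (smult A c x) = smult B c (h x)"
      "\<And>x y. h (alg.mult A x y) = alg.mult B (h x) (h y)"
  shows "(type_alg scale mult, g ` S) \<cong> (B, h ` S)"
proof -
  define f where "f w = h (inv g w)" for w
  have surj: "surj g" using g generates by (rule surj_alg_hom)
  have f: "f (g x) = h x" for x
    unfolding f_def kernel[symmetric] by (simp add: surj_f_inv_f[OF surj])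
  have ex: "\<exists>x. w = g x" for w using surj by (rule surjD)
  have "inj f"
  proof (rule injI)
    fix u w assume "f u = f w"
    moreover obtain x y where "u = g x" "w = g y" using ex by blast
    ultimately show "u = w" by (simp add: f kernel)
  qed
  moreover have "range f = carrier B"
  proof -
    have "range f = f ` range g" by (simp add: surj)
    also have "\<dots> = carrier B" by (simp add: image_image f range)
    finally show ?thesis .
  qed
  moreover have "f (u + w) = add B (f u) (f w)" "f (u \<cdot> w) = alg.mult B (f u) (f w)"
    "f (c *s u) = smult B c (f u)" for u w c
  proof -
    obtain x y where "u = g x" "w = g y" using ex by blast
    then show "f (u + w) = add B (f u) (f w)" "f (u \<cdot> w) = alg.mult B (f u) (f w)"
      "f (c *s u) = smult B c (f u)"
      by (simp_all add: f hom flip: alg_homD(2-4)[OF g])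
  qed
  moreover have "f ` g ` S = h ` S" by (simp add: image_image f)
  ultimately show ?thesis
    unfolding isomorphic_def by (auto simp: type_alg_def bij_betw_def intro!: exI[of _ f])
qed

lemma isomorphic_if_inj:
  assumes "alg_hom A g" and "subalgebra hull (g ` S) = UNIV" and "inj g"
  shows "(type_alg scale mult, g ` S) \<cong> (A, S)"
  using isomorphic_if_same_kernel[OF assms(1,2), of id] assms(3) alg_homD(1)[OF assms(1)]
  by (simp add: inj_eq)

definition kernel_spanned_by :: "('f, 'a) alg \<Rightarrow> ('a \<Rightarrow> 'm) \<Rightarrow> 'a \<Rightarrow> bool" where
  "kernel_spanned_by A g v \<longleftrightarrow> (\<forall>x y. g x = g y \<longleftrightarrow> (\<exists>c. y = add A x (smult A c v)))"

lemma isomorphic_axial_quotient: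
  assumes g: "alg_hom A g" and generates: "subalgebra hull (g ` S) = UNIV"
    and kernel: "kernel_spanned_by A g v"
  shows "(type_alg scale mult, g ` S) \<cong> axial_quotient (A, S) v"
proof -
  note hom = alg_homD[OF g]
  define I where "I = range (\<lambda>c. smult A c v)"
  have coset: "coset A I x = {y. g x = g y}" for x
    by (simp add: kernel[unfolded kernel_spanned_by_def, rule_format]) (auto simp: coset_def I_def)
  have "(type_alg scale mult, g ` S) \<cong> (quotient_alg A I, coset A I ` S)"
  proof (rule isomorphic_if_same_kernel[OF g generates])
    show "g x = g y \<longleftrightarrow> coset A I x = coset A I y" for x y
      unfolding coset by auto
    show "coset A I (add A x y) = add (quotient_alg A I) (coset A I x) (coset A I y)"
      "coset A I (smult A c x) = smult (quotient_alg A I) c (coset A I x)"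
      "coset A I (alg.mult A x y) = alg.mult (quotient_alg A I) (coset A I x) (coset A I y)"
      for x y c
      unfolding quotient_alg_def alg.simps coset hom by auto
  qed (simp add: quotient_alg_def hom)
  then show ?thesis by (simp add: axial_quotient_def I_def Let_def)
qed

lemma alg_hom_line_alg: "e \<cdot> e = e \<Longrightarrow> alg_hom line_alg (\<lambda>t. t *s e)"
  by (simp add: alg_hom_def line_alg_def scale_left_distrib bilinear)

lemma alg_hom_direct_sum:
  assumes g: "alg_hom K g" and h: "alg_hom L h" and orthogonal: "\<And>x u. g x \<cdot> h u = 0"
  shows "alg_hom (K \<oplus> L) (\<lambda>x. g (fst x) + h (snd x))"
  unfolding alg_hom_def direct_sum_def
  by (auto simp: alg_homD[OF g] alg_homD[OF h] bilinear orthogonal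
      mult_commute[of "h _" "g _"] scale_right_distrib algebra_simps)

lemma direct_sum_kernel:
  assumes e: "\<And>x. e \<cdot> g x = 0" "\<And>u. e \<cdot> h u = h u" and "inj h"
  shows "g x + h u = g y + h w \<longleftrightarrow> g x = g y \<and> u = w"
proof
  assume eq: "g x + h u = g y + h w"
  have "h u = h w" using arg_cong[OF eq, of "mult e"] by (simp add: mult_add_right e)
  with eq \<open>inj h\<close> show "g x = g y \<and> u = w" by (simp add: inj_eq)
qed simp

definition hom_2A :: "'m \<Rightarrow> 'm \<Rightarrow> 'f \<times> 'f \<Rightarrow> 'm" where
  "hom_2A s0 s1 u = fst u *s s0 + snd u *s s1"

context
  fixes s0 s1 :: 'm
  assumes idem: "s0 \<cdot> s0 = s0" "s1 \<cdot> s1 = s1" and orthogonal: "s0 \<cdot> s1 = 0"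
begin

lemma alg_hom_hom_2A: "alg_hom alg_2A (hom_2A s0 s1)"
  unfolding alg_2A_def hom_2A_def[abs_def]
  by (rule alg_hom_direct_sum) (simp_all add: alg_hom_line_alg bilinear idem orthogonal)

lemma inj_hom_2A:
  assumes "s0 \<noteq> 0" "s1 \<noteq> 0"
  shows "inj (hom_2A s0 s1)"
proof (rule injI)
  fix u w assume eq: "hom_2A s0 s1 u = hom_2A s0 s1 w"
  have "s1 \<cdot> s0 = 0" using orthogonal by (simp add: mult_commute)
  then show "u = w"
    using arg_cong[OF eq, of "mult s0"] arg_cong[OF eq, of "mult s1"] assms
    by (simp add: hom_2A_def bilinear idem orthogonal prod_eq_iff)
qed

lemma s_sum_mult_hom_2A: "(s0 + s1) \<cdot> hom_2A s0 s1 u = hom_2A s0 s1 u"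
  by (simp add: hom_2A_def bilinear idem orthogonal mult_commute[of s1 s0])

end

definition lincomb :: "('i::finite \<Rightarrow> 'm) \<Rightarrow> ('i \<Rightarrow> 'f) \<Rightarrow> 'm" where
  "lincomb v x = (\<Sum>i\<in>UNIV. x i *s v i)"

lemma lincomb_diff: "lincomb v (\<lambda>k. x k - y k) = lincomb v x - lincomb v y"
  by (simp add: lincomb_def scale_left_diff_distrib sum_subtractf)

lemma lincomb_basis_vec: "lincomb v (basis_vec i) = v i"
  by (simp add: lincomb_def basis_vec_def if_distrib[of "\<lambda>c. c *s _"] cong: if_cong)

lemma inj_lincomb:
  assumes "\<And>x. lincomb v x = 0 \<Longrightarrow> x = (\<lambda>k. 0)"
  shows "inj (lincomb v)"
proof (rule injI)
  fix x y assume "lincomb v x = lincomb v y"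
  then have "(\<lambda>k. x k - y k) = (\<lambda>k. 0)" by (intro assms) (simp add: lincomb_diff)
  then show "x = y" by (simp add: fun_eq_iff)
qed

lemma kernel_spanned_by_lincomb:
  assumes "lincomb v w = 0" and span: "\<And>x. lincomb v x = 0 \<Longrightarrow> \<exists>c. x = (\<lambda>k. c * w k)"
  shows "kernel_spanned_by (basis_alg \<gamma>) (lincomb v) w"
  unfolding kernel_spanned_by_def
proof (intro allI iffI)
  fix x y assume "lincomb v x = lincomb v y"
  then obtain c where "(\<lambda>k. y k - x k) = (\<lambda>k. c * w k)"
    using span[of "\<lambda>k. y k - x k"] by (auto simp: lincomb_diff)
  then have "y = (\<lambda>k. x k + c * w k)" by (simp add: fun_eq_iff algebra_simps)
  then show "\<exists>c. y = add (basis_alg \<gamma>) x (smult (basis_alg \<gamma>) c w)" by (auto simp: basis_alg_def)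
next
  fix x y assume "\<exists>c. y = add (basis_alg \<gamma>) x (smult (basis_alg \<gamma>) c w)"
  moreover have "lincomb v (\<lambda>k. x k + c * w k) = lincomb v x + c *s lincomb v w" for c
    by (simp add: lincomb_def scale_left_distrib sum.distrib scale_sum_right)
  ultimately show "lincomb v x = lincomb v y" using assms(1) by (auto simp: basis_alg_def)
qed

lemma alg_hom_basis_alg:
  assumes "\<And>i j. v i \<cdot> v j = lincomb v (\<gamma> i j)"
  shows "alg_hom (basis_alg \<gamma>) (lincomb v)"
proof -
  have "lincomb v x \<cdot> lincomb v y = lincomb v (\<lambda>k. \<Sum>i\<in>UNIV. \<Sum>j\<in>UNIV. x i * y j * \<gamma> i j k)" for x y
  proof -
    have "lincomb v x \<cdot> lincomb v y =
        (\<Sum>i\<in>UNIV. \<Sum>j\<in>UNIV. \<Sum>k\<in>UNIV. (x i * y j * \<gamma> i j k) *s v k)"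
      by (simp add: lincomb_def mult_sum_left mult_sum_right mult_scale_left mult_scale_right
          assms scale_sum_right ac_simps) (rule sum.swap)
    also have "\<dots> = (\<Sum>i\<in>UNIV. \<Sum>k\<in>UNIV. \<Sum>j\<in>UNIV. (x i * y j * \<gamma> i j k) *s v k)"
      by (intro sum.cong refl sum.swap)
    also have "\<dots> = (\<Sum>k\<in>UNIV. \<Sum>i\<in>UNIV. \<Sum>j\<in>UNIV. (x i * y j * \<gamma> i j k) *s v k)"
      by (rule sum.swap)
    finally show ?thesis by (simp add: lincomb_def scale_sum_left)
  qed
  then show ?thesis
    by (simp add: alg_hom_def basis_alg_def lincomb_def scale_left_distrib sum.distrib
        scale_sum_right)
qed

end

section \<open>Classification\<close>

context hat_3C_relations
begin

lemma hat_3C_relations_swapped: "hat_3C_relations scale mult \<eta> (\<lambda>i. A (1 - i)) q s1 s0"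
  using two_neq_0 \<eta>_neq_0 \<eta>_neq_1 A_mult
  by unfold_locales (simp_all add: A_idem q_mult_A q_square s0_idem s1_idem s0_mult_s1 s0_mult_A
      s1_mult_A s0_mult_q s1_mult_q mult_commute[of s1 s0])

lemma A_mult_add:
  assumes "distinct [i, j, k]"
  shows "A i \<cdot> (A j + A k) = (\<eta> + 1) *s A i + A j + A k - q"
proof (rule scale_left_imp_eq[OF two_neq_0])
  have swapped: "distinct [i, k, j]" using assms by auto
  show "2 *s (A i \<cdot> (A j + A k)) = 2 *s ((\<eta> + 1) *s A i + A j + A k - q)"
    using A_mult[OF assms] A_mult[OF swapped] unfolding bilinear
    by (intro coordinate_eqI) (elim coordinate_eqE, unfold coordinate_simps, algebra)
qed

lemma A_mult_diff:
  assumes "distinct [i, j, k]"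
  shows "A i \<cdot> (A j - A k) = \<eta> *s (A j - A k)"
proof (rule scale_left_imp_eq[OF two_neq_0])
  have swapped: "distinct [i, k, j]" using assms by auto
  show "2 *s (A i \<cdot> (A j - A k)) = 2 *s \<eta> *s (A j - A k)"
    using A_mult[OF assms] A_mult[OF swapped] unfolding bilinear
    by (intro coordinate_eqI) (elim coordinate_eqE, unfold coordinate_simps, algebra)
qed

lemma A_mult_q: "A i \<cdot> q = (\<eta> + 1) *s A i"
  by (simp add: mult_commute[of "A i"] q_mult_A)

lemma third_A_eq_if_A_eq:
  assumes "distinct [i, j, k]" and eq: "A i = A j"
  shows "A k = A i"
proof -
  have q: "q = (2 * \<eta>) *s A i + (1 - \<eta>) *s A k"
    using A_mult[OF assms(1)] unfolding eq[symmetric] A_idem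
    by (intro coordinate_eqI) (elim coordinate_eqE, unfold coordinate_simps, algebra)
  have "(1 - \<eta>) *s (A i \<cdot> A k) = (1 - \<eta>) *s A i"
    using arg_cong[OF q, of "mult (A i)"] unfolding bilinear A_mult_q A_idem
    by (intro coordinate_eqI) (elim coordinate_eqE, unfold coordinate_simps, algebra)
  then have "A i \<cdot> A k = A i" using \<eta>_neq_1 by simp
  then have "\<eta> *s (A i - A k) = 0"
    using A_mult_diff[OF assms(1)] unfolding eq[symmetric] by (simp add: bilinear A_idem)
  then show ?thesis using \<eta>_neq_0 by simp
qed

lemma inj_A:
  assumes "A 0 \<noteq> A 1"
  shows "inj A"
proof (rule injI, rule ccontr)
  fix i j assume "A i = A j" "i \<noteq> j"
  then obtain k where k: "distinct [i, j, k]" using obtain_third_3 by blast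
  have "A l = A i" for l
    using distinct_UNIV_3[OF k] third_A_eq_if_A_eq[OF k \<open>A i = A j\<close>] \<open>A i = A j\<close> by auto
  with assms show False by metis
qed

text \<open>Vanishes exactly if the relations are those of \<open>3C\<close>, in which \<open>q\<close> is the sum of the axes.\<close>

definition rad :: 'm where "rad = q - (\<Sum>i\<in>UNIV. A i)"

lemma A_mult_rad: "A i \<cdot> rad = rad"
proof -
  obtain j where "i \<noteq> j" by (metis zero_neq_one)
  then obtain k where k: "distinct [i, j, k]" by (rule obtain_third_3)
  have "rad = q - A i - (A j + A k)" by (simp add: rad_def sum_distinct_3[OF k] algebra_simps)
  moreover have "A i \<cdot> (q - A i - (A j + A k)) = q - A i - (A j + A k)"
    unfolding mult_diff_right A_mult_q A_idem A_mult_add[OF k]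
    by (simp add: algebra_simps)
  ultimately show ?thesis by simp
qed

definition hat_hom :: "(3 option \<Rightarrow> 'f) \<Rightarrow> 'm" where
  "hat_hom = lincomb (case_option q A)"

lemma hat_hom_eq: "hat_hom x = x None *s q + (\<Sum>i\<in>UNIV. x (Some i) *s A i)"
  by (simp add: hat_hom_def lincomb_def UNIV_option_conv sum.reindex)

lemma coeff_eq_if_hat_hom_eq_0:
  assumes x: "hat_hom x = 0" and "inj A"
  shows "x (Some j) = x (Some k)"
proof (cases "j = k")
  case False
  then obtain i where "distinct [j, k, i]" by (rule obtain_third_3)
  then have i: "distinct [i, j, k]" by auto
  let ?y = "\<lambda>l. x (Some l)"
  define S where "S = A j + A k"
  \<comment> \<open>\<open>v\<close> is the part of \<open>2 *s hat_hom x\<close> that the involution of \<open>A i\<close> fixes.\<close>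
  define v where "v = (2 * x None) *s q + (2 * ?y i) *s A i + (?y j + ?y k) *s S"
  have "v + (?y j - ?y k) *s (A j - A k) = 2 *s hat_hom x"
    unfolding v_def S_def hat_hom_eq sum_distinct_3[OF i]
    by (rule coordinate_eqI, unfold coordinate_simps, algebra)
  then have v: "v = - ((?y j - ?y k) *s (A j - A k))" using x by (simp add: eq_neg_iff_add_eq_0)
  have "A i \<cdot> S = (\<eta> + 1) *s A i + S - q"
    using A_mult_add[OF i] by (simp add: S_def algebra_simps)
  then have "A i \<cdot> (A i \<cdot> v) = A i \<cdot> v"
    by (simp add: v_def bilinear A_mult_q A_idem)
  then have "(\<eta> * (\<eta> - 1) * (?y j - ?y k)) *s (A j - A k) = 0"
    unfolding v mult_minus_right mult_scale_right A_mult_diff[OF i]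
    by (intro coordinate_eqI) (elim coordinate_eqE, unfold coordinate_simps, algebra)
  moreover have "A j \<noteq> A k" using False \<open>inj A\<close> by (simp add: inj_eq)
  ultimately show ?thesis using \<eta>_neq_0 \<eta>_neq_1 by simp
qed simp

lemma hat_hom_eq_0E:
  assumes x: "hat_hom x = 0" and "A 0 \<noteq> A 1"
  obtains t where "\<And>i. x (Some i) = t" "(x None + t) * (\<eta> + 1) = 0" "t *s rad = 0"
    "(x None + t) *s q = 0"
proof -
  define t where "t = x (Some 0)"
  have t: "x (Some i) = t" for i
    unfolding t_def using coeff_eq_if_hat_hom_eq_0[OF x inj_A] assms(2) by blast
  have q: "(x None + t) *s q = t *s rad"
    using x by (simp add: hat_hom_eq t rad_def scale_left_distrib scale_right_diff_distrib
        scale_sum_right eq_neg_iff_add_eq_0 add.commute flip: scale_sum_right)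
  have A: "((x None + t) * (\<eta> + 1)) *s A i = t *s rad" for i
    using arg_cong[OF q, of "mult (A i)"] by (simp add: mult_scale_right A_mult_q A_mult_rad)
  have vanishes: "(x None + t) * (\<eta> + 1) = 0"
    using A[of 0] A[of 1] assms(2) by (metis scale_left_imp_eq)
  moreover have "t *s rad = 0" using A[of 0] unfolding vanishes by simp
  moreover have "(x None + t) *s q = 0" unfolding q by fact
  ultimately show ?thesis using that t by blast
qed

lemma lincomb_A_eq_hat_hom: "lincomb A x = hat_hom (case_option 0 x)"
  by (simp add: hat_hom_eq lincomb_def)

lemma A_mult_halved:
  assumes "distinct [i, j, k]"
  shows "A i \<cdot> A j = (- (1 / 2)) *s q + ((\<eta> + 1) / 2) *s (A i + A j) + ((1 - \<eta>) / 2) *s A k"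
proof (rule scale_left_imp_eq[OF two_neq_0])
  show "2 *s (A i \<cdot> A j) =
      2 *s ((- (1 / 2)) *s q + ((\<eta> + 1) / 2) *s (A i + A j) + ((1 - \<eta>) / 2) *s A k)"
    unfolding A_mult[OF assms] scale_right_distrib scale_scale using two_neq_0
    by (simp del: distrib_left_numeral right_diff_distrib_numeral)
qed

lemma hat_hom_vec: "hat_hom (hat_a_vec i) = A i" "hat_hom hat_q_vec = q"
  using lincomb_basis_vec[of "case_option q A" "Some i"]
    lincomb_basis_vec[of "case_option q A" None]
  by (simp_all add: hat_hom_def)

lemma alg_hom_hat_hom: "alg_hom (alg_hat_3C \<eta>) hat_hom"
proof -
  have "A i \<cdot> A j = hat_hom (hat_3C_coeff \<eta> (Some i) (Some j))" if neq: "i \<noteq> j" for i j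
  proof -
    obtain k where k: "distinct [i, j, k]" by (rule obtain_third_3[OF neq])
    then show ?thesis
      by (auto simp: hat_hom_eq sum_distinct_3[OF k] A_mult_halved[OF k] scale_right_distrib)
  qed
  moreover have "hat_hom (\<lambda>k. c * basis_vec a k) = c *s case_option q A a" for c a
    using lincomb_basis_vec[of "case_option q A" a]
    by (simp add: hat_hom_def lincomb_def flip: scale_scale scale_sum_right)
  ultimately have "case_option q A a \<cdot> case_option q A b = hat_hom (hat_3C_coeff \<eta> a b)" for a b
    by (cases a; cases b) (auto simp: hat_hom_vec q_mult_A A_mult_q q_square A_idem)
  then show ?thesis
    unfolding alg_hat_3C_def hat_hom_def by (rule alg_hom_basis_alg)
qed

lemma alg_hom_lincomb_A:
  assumes "rad = 0"
  shows "alg_hom (alg_3C \<eta>) (lincomb A)"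
proof -
  have "A i \<cdot> A j = lincomb A (\<lambda>k. if k \<in> {i, j} then \<eta> / 2 else - (\<eta> / 2))" if neq: "i \<noteq> j" for i j
  proof -
    obtain k where k: "distinct [i, j, k]" by (rule obtain_third_3[OF neq])
    have q: "q = A i + A j + A k"
      using assms by (simp add: rad_def sum_distinct_3[OF k])
    have "A i \<cdot> A j = (- (1 / 2) + (\<eta> + 1) / 2) *s (A i + A j) + (- (1 / 2) + (1 - \<eta>) / 2) *s A k"
      unfolding A_mult_halved[OF k] q by (simp only: scale_left_distrib scale_right_distrib add_ac)
    also have "- (1 / 2) + (\<eta> + 1) / 2 = \<eta> / 2"
      by (simp add: add_divide_distrib)
    also have "- (1 / 2) + (1 - \<eta>) / 2 = - (\<eta> / 2)"
      by (simp add: diff_divide_distrib)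
    finally have "A i \<cdot> A j = (\<eta> / 2) *s (A i + A j) + (- (\<eta> / 2)) *s A k" .
    then show ?thesis
      using k by (auto simp: lincomb_def sum_distinct_3[OF k] scale_right_distrib)
  qed
  then have "A i \<cdot> A j = lincomb A (if i = j then basis_vec i
      else (\<lambda>k. if k \<in> {i, j} then \<eta> / 2 else - (\<eta> / 2)))" for i j
    by (simp add: A_idem lincomb_basis_vec)
  then show ?thesis
    unfolding alg_3C_def by (rule alg_hom_basis_alg)
qed

lemma s_mult_hat_hom: "s0 \<cdot> hat_hom x = 0" "s1 \<cdot> hat_hom x = 0"
  by (simp_all add: hat_hom_eq mult_add_right mult_sum_right mult_scale_right
      s0_mult_A s1_mult_A s0_mult_q s1_mult_q)

lemma s_mult_lincomb_A: "s0 \<cdot> lincomb A x = 0" "s1 \<cdot> lincomb A x = 0"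
  by (simp_all add: lincomb_A_eq_hat_hom s_mult_hat_hom)

end

definition isomorphic_to_one_of_six_quotients :: "('f::field, 'a) axial \<Rightarrow> bool" where
  "isomorphic_to_one_of_six_quotients X \<longleftrightarrow>
     X \<cong> ax_3C_cross \<or> X \<cong> ax_hat_3C_cross \<or> X \<cong> ax_3C0_cross \<or> X \<cong> ax_3C00_cross \<or>
     X \<cong> ax_hat_3C0_cross \<or> X \<cong> ax_hat_3C00_cross"

locale hat_3C_generated = hat_3C_relations scale mult \<eta> A q s0 s1
  for scale :: "'f::field \<Rightarrow> 'm::ab_group_add \<Rightarrow> 'm" (infixr \<open>*s\<close> 75)
    and mult :: "'m \<Rightarrow> 'm \<Rightarrow> 'm" (infixl \<open>\<cdot>\<close> 70)
    and \<eta> :: 'f and A :: "3 \<Rightarrow> 'm" and q s0 s1 :: 'm +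
  assumes generates: "subalgebra hull {A 0 + s0, A 1 + s1} = UNIV"
    and nonzero: "A 0 + s0 \<noteq> 0" "A 1 + s1 \<noteq> 0"
begin

abbreviation X :: "('f, 'm) axial" where
  "X \<equiv> (type_alg scale mult, {A 0 + s0, A 1 + s1})"

context
  fixes K :: "('f, 'k) alg" and g :: "'k \<Rightarrow> 'm" and k0 k1 :: 'k
  assumes g: "alg_hom K g" "g k0 = A 0" "g k1 = A 1" "\<And>x. s0 \<cdot> g x = 0" "\<And>x. s1 \<cdot> g x = 0"
    and s: "s0 \<noteq> 0 \<Longrightarrow> s1 \<noteq> 0"
begin

lemma g_mult_s: "g x \<cdot> s0 = 0" "g x \<cdot> s1 = 0"
  using g(4,5) by (simp_all add: mult_commute)

lemma extension_cases:
  obtains "g ` {k0, k1} = {A 0 + s0, A 1 + s1}"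
  | G where "alg_hom (K \<oplus> line_alg) G" "G ` {(k0, 0), (k1, 1)} = {A 0 + s0, A 1 + s1}"
      "\<And>x y. G x = G y \<longleftrightarrow> g (fst x) = g (fst y) \<and> snd x = snd y"
  | G where "alg_hom (K \<oplus> alg_2A) G" "G ` {(k0, 1, 0), (k1, 0, 1)} = {A 0 + s0, A 1 + s1}"
      "\<And>x y. G x = G y \<longleftrightarrow> g (fst x) = g (fst y) \<and> snd x = snd y"
proof -
  consider "s0 = 0" "s1 = 0" | "s0 = 0" "s1 \<noteq> 0" | "s0 \<noteq> 0" "s1 \<noteq> 0" using s by blast
  then show ?thesis
  proof cases
    case 1
    then show ?thesis using that(1) g by simp
  next
    case 2
    show ?thesis
    proof (rule that(2))
      show "alg_hom (K \<oplus> line_alg) (\<lambda>x. g (fst x) + snd x *s s1)"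
        by (rule alg_hom_direct_sum[OF g(1) alg_hom_line_alg[OF s1_idem]])
          (simp add: bilinear g_mult_s)
      show "g (fst x) + snd x *s s1 = g (fst y) + snd y *s s1 \<longleftrightarrow>
          g (fst x) = g (fst y) \<and> snd x = snd y" for x y
        by (rule direct_sum_kernel[of s1]) (use 2 in \<open>auto simp: bilinear g s1_idem intro: injI\<close>)
    qed (use 2 g in auto)
  next
    case 3
    note idem = s0_idem s1_idem s0_mult_s1
    show ?thesis
    proof (rule that(3))
      show "alg_hom (K \<oplus> alg_2A) (\<lambda>x. g (fst x) + hom_2A s0 s1 (snd x))"
        by (rule alg_hom_direct_sum[OF g(1) alg_hom_hom_2A[OF idem]])
          (simp add: hom_2A_def bilinear g_mult_s)
      show "g (fst x) + hom_2A s0 s1 (snd x) = g (fst y) + hom_2A s0 s1 (snd y) \<longleftrightarrow>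
          g (fst x) = g (fst y) \<and> snd x = snd y" for x y
        by (rule direct_sum_kernel[OF _ s_sum_mult_hom_2A[OF idem] inj_hom_2A[OF idem 3]])
          (simp add: mult_add_left g)
    qed (use g in \<open>auto simp: hom_2A_def\<close>)
  qed
qed

lemma isomorphic_extension:
  assumes "inj g"
  shows "X \<cong> (K, {k0, k1}) \<or> X \<cong> (K \<oplus> line_alg, {(k0, 0), (k1, 1)}) \<or>
    X \<cong> (K \<oplus> alg_2A, {(k0, 1, 0), (k1, 0, 1)})"
proof (cases rule: extension_cases)
  case 1
  then show ?thesis using isomorphic_if_inj[OF g(1), of "{k0, k1}"] generates assms by simp
next
  case (2 G)
  then have "inj G" using assms by (auto intro!: injI simp: inj_eq prod_eq_iff)
  with 2 show ?thesis
    using isomorphic_if_inj[OF 2(1), of "{(k0, 0), (k1, 1)}"] generates by simp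
next
  case (3 G)
  then have "inj G" using assms by (auto intro!: injI simp: inj_eq prod_eq_iff)
  with 3 show ?thesis
    using isomorphic_if_inj[OF 3(1), of "{(k0, 1, 0), (k1, 0, 1)}"] generates by simp
qed

lemma isomorphic_quotient_extension:
  assumes kernel: "kernel_spanned_by K g v"
  shows "X \<cong> axial_quotient (K, {k0, k1}) v \<or>
    X \<cong> axial_quotient (K \<oplus> line_alg, {(k0, 0), (k1, 1)}) (v, 0) \<or>
    X \<cong> axial_quotient (K \<oplus> alg_2A, {(k0, 1, 0), (k1, 0, 1)}) (v, 0, 0)"
proof (cases rule: extension_cases)
  case 1
  then show ?thesis
    using isomorphic_axial_quotient[OF g(1), of "{k0, k1}"] generates kernel by simp
next
  case (2 G)
  then have "kernel_spanned_by (K \<oplus> line_alg) G (v, 0)"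
    using kernel by (auto simp: kernel_spanned_by_def direct_sum_def line_alg_def prod_eq_iff)
  with 2 show ?thesis
    using isomorphic_axial_quotient[OF 2(1), of "{(k0, 0), (k1, 1)}"] generates by simp
next
  case (3 G)
  then have "kernel_spanned_by (K \<oplus> alg_2A) G (v, 0, 0)"
    using kernel
    by (auto simp: kernel_spanned_by_def direct_sum_def alg_2A_def line_alg_def prod_eq_iff)
  with 3 show ?thesis
    using isomorphic_axial_quotient[OF 3(1), of "{(k0, 1, 0), (k1, 0, 1)}"] generates by simp
qed

end

lemma classification_equal_axes:
  assumes eq: "A 0 = A 1" and s: "s0 \<noteq> 0 \<Longrightarrow> s1 \<noteq> 0"
  shows "isomorphic_to_one_of_ten X \<eta>"
proof (cases "A 0 = 0")
  case True
  note idem = s0_idem s1_idem s0_mult_s1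
  have "s0 \<noteq> 0" "s1 \<noteq> 0" using nonzero True eq by auto
  then have "inj (hom_2A s0 s1)" by (rule inj_hom_2A[OF idem])
  moreover have axes: "hom_2A s0 s1 ` {(1, 0), (0, 1)} = {A 0 + s0, A 1 + s1}"
    using True eq by (simp add: hom_2A_def)
  ultimately have "X \<cong> (alg_2A, {(1, 0), (0, 1)})"
    using isomorphic_if_inj[OF alg_hom_hom_2A[OF idem], of "{(1, 0), (0, 1)}"] generates
    by (simp only: axes)
  then show ?thesis by (simp add: isomorphic_to_one_of_ten_def ax_2A_def)
next
  case False
  have "inj (\<lambda>t. t *s A 0)" using False by (auto intro: injI)
  then have "X \<cong> (line_alg, {1, 1}) \<or> X \<cong> (line_alg \<oplus> line_alg, {(1, 0), (1, 1)}) \<or>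
      X \<cong> (line_alg \<oplus> alg_2A, {(1, 1, 0), (1, 0, 1)})"
    by (intro isomorphic_extension[OF alg_hom_line_alg[OF A_idem[of 0]]])
      (simp_all add: eq s mult_scale_right s0_mult_A s1_mult_A)
  then show ?thesis
    by (auto simp: isomorphic_to_one_of_ten_def ax_1A_def ax_hat_1A_def ax_hat_2A_def)
qed

context
  assumes neq: "A 0 \<noteq> A 1" and s: "s0 \<noteq> 0 \<Longrightarrow> s1 \<noteq> 0"
begin

lemmas hat_extension = alg_hom_hat_hom hat_hom_vec(1)[of 0] hat_hom_vec(1)[of 1] s_mult_hat_hom s

lemma classification_hat_3C:
  assumes "rad \<noteq> 0" and "\<not> (\<eta> = - 1 \<and> q = 0)"
  shows "isomorphic_to_one_of_ten X \<eta>"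
proof -
  have "x = (\<lambda>k. 0)" if x: "hat_hom x = 0" for x
  proof -
    obtain t where t: "\<And>i. x (Some i) = t" "(x None + t) * (\<eta> + 1) = 0" "t *s rad = 0"
      "(x None + t) *s q = 0"
      by (rule hat_hom_eq_0E[OF x neq]) (rule that)
    have "t = 0" using t(3) assms(1) by simp
    moreover from this have "x None = 0"
      using t(2,4) assms(2) by (auto simp: eq_neg_iff_add_eq_0)
    ultimately show ?thesis using t(1) by (metis option.exhaust ext)
  qed
  then have "inj hat_hom" unfolding hat_hom_def by (intro inj_lincomb)
  from isomorphic_extension[OF hat_extension this] show ?thesis
    by (auto simp: isomorphic_to_one_of_ten_def ax_hat_3C_def ax_hat_3C0_def ax_hat_3C00_def)
qed

lemma classification_hat_3C_quotient:
  assumes "rad \<noteq> 0" and "\<eta> = - 1" "q = 0"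
  shows "isomorphic_to_one_of_six_quotients X"
proof -
  have "\<exists>c. x = (\<lambda>k. c * hat_q_vec k)" if x: "hat_hom x = 0" for x
  proof -
    obtain t where t: "\<And>i. x (Some i) = t" "t *s rad = 0"
      by (rule hat_hom_eq_0E[OF x neq]) (rule that)
    then have "x (Some i) = 0" for i using assms(1) by simp
    then have "x k = x None * hat_q_vec k" for k by (cases k) (simp_all add: basis_vec_def)
    then show ?thesis by blast
  qed
  moreover have "hat_hom hat_q_vec = 0" by (rule trans[OF hat_hom_vec(2) assms(3)])
  ultimately have "kernel_spanned_by (alg_hat_3C \<eta>) hat_hom hat_q_vec"
    unfolding alg_hat_3C_def hat_hom_def by (intro kernel_spanned_by_lincomb)
  from isomorphic_quotient_extension[OF hat_extension this] show ?thesis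
    using assms(2) by (auto simp: isomorphic_to_one_of_six_quotients_def ax_hat_3C_cross_def
        ax_hat_3C0_cross_def ax_hat_3C00_cross_def ax_hat_3C_def ax_hat_3C0_def ax_hat_3C00_def)
qed

lemma lincomb_A_eq_0E:
  assumes "lincomb A x = 0"
  obtains t where "x = (\<lambda>k. t * a_sum k)" "t * (\<eta> + 1) = 0" "t *s q = 0"
proof -
  have x: "hat_hom (case_option 0 x) = 0" using assms by (simp add: lincomb_A_eq_hat_hom)
  obtain t where t: "\<And>i. x i = t" "t * (\<eta> + 1) = 0" "t *s q = 0"
    by (rule hat_hom_eq_0E[OF x neq]) (use that in simp)
  have "a_sum k = (1 :: 'f)" for k
    using UNIV_3 by (auto simp: a_sum_def basis_vec_def)
  then have "x = (\<lambda>k. t * a_sum k)" using t(1) by (simp add: fun_eq_iff)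
  then show ?thesis using t(2,3) by (rule that)
qed

context
  assumes rad: "rad = 0"
begin

lemmas extension_3C = alg_hom_lincomb_A[OF rad] lincomb_basis_vec[of A 0] lincomb_basis_vec[of A 1]
  s_mult_lincomb_A s

lemma classification_3C:
  assumes "\<not> (\<eta> = - 1 \<and> q = 0)"
  shows "isomorphic_to_one_of_ten X \<eta>"
proof -
  have "x = (\<lambda>k. 0)" if x: "lincomb A x = 0" for x
    by (rule lincomb_A_eq_0E[OF x]) (use assms in \<open>auto simp: eq_neg_iff_add_eq_0\<close>)
  then have "inj (lincomb A)" by (rule inj_lincomb)
  from isomorphic_extension[OF extension_3C this] show ?thesis
    by (auto simp: isomorphic_to_one_of_ten_def ax_3C_def ax_3C0_def ax_3C00_def)
qed

lemma classification_3C_quotient: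
  assumes "\<eta> = - 1" "q = 0"
  shows "isomorphic_to_one_of_six_quotients X"
proof -
  have "lincomb A a_sum = q"
    using rad sum_distinct_3[of 0 1 "-1" A]
    by (simp add: lincomb_def sum_distinct_3[of 0 1 "-1"] rad_def a_sum_def basis_vec_def)
  then have "kernel_spanned_by (alg_3C \<eta>) (lincomb A) a_sum"
    unfolding alg_3C_def using assms(2) lincomb_A_eq_0E
    by (intro kernel_spanned_by_lincomb) (simp, blast)
  from isomorphic_quotient_extension[OF extension_3C this] show ?thesis
    using assms(1) by (auto simp: isomorphic_to_one_of_six_quotients_def ax_3C_cross_def
        ax_3C0_cross_def ax_3C00_cross_def ax_3C_def ax_3C0_def ax_3C00_def)
qed

end

end

lemma classification:
  assumes s: "s0 \<noteq> 0 \<Longrightarrow> s1 \<noteq> 0"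
  shows "isomorphic_to_one_of_ten X \<eta> \<or> \<eta> = - 1 \<and> isomorphic_to_one_of_six_quotients X"
proof (cases "A 0 = A 1")
  case True
  then show ?thesis using classification_equal_axes s by simp
next
  case False
  note classes = classification_3C[OF this s] classification_3C_quotient[OF this s]
    classification_hat_3C[OF this s] classification_hat_3C_quotient[OF this s]
  show ?thesis
    using classes by (cases "rad = 0"; cases "\<eta> = - 1 \<and> q = 0") simp_all
qed

end

lemma (in hat_3C_relations) classification_if_generates:
  assumes "subalgebra hull {A 0 + s0, A 1 + s1} = UNIV" "A 0 + s0 \<noteq> 0" "A 1 + s1 \<noteq> 0"
  shows "isomorphic_to_one_of_ten (type_alg scale mult, {A 0 + s0, A 1 + s1}) \<eta> \<or>
    \<eta> = - 1 \<and> isomorphic_to_one_of_six_quotients (type_alg scale mult, {A 0 + s0, A 1 + s1})"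
proof (cases "s0 \<noteq> 0 \<longrightarrow> s1 \<noteq> 0")
  case True
  have "hat_3C_generated scale mult \<eta> A q s0 s1"
    using hat_3C_relations_axioms assms
    by (intro hat_3C_generated.intro hat_3C_generated_axioms.intro)
  from hat_3C_generated.classification[OF this] show ?thesis using True by simp
next
  case False
  have "hat_3C_generated scale mult \<eta> (\<lambda>i. A (1 - i)) q s1 s0"
    using hat_3C_relations_swapped assms
    by (intro hat_3C_generated.intro hat_3C_generated_axioms.intro) (simp_all add: insert_commute)
  from hat_3C_generated.classification[OF this] show ?thesis
    using False by (simp add: insert_commute)
qed

lemma two_neq_0_if_CHAR_neq_2:
  assumes "CHAR('f::field) \<noteq> 2"
  shows "(2::'f) \<noteq> 0"
proof
  assume "(2::'f) = 0"
  then have "CHAR('f) dvd 2" using of_nat_eq_0_iff_char_dvd[of 2, where 'a='f] by simp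
  then have "CHAR('f) \<le> 2" "CHAR('f) \<noteq> 0" by (auto dest: dvd_imp_le intro: ccontr)
  then show False using assms CHAR_not_1[where 'a='f] by auto
qed

theorem theorem3:
  fixes scale :: "'f::field \<Rightarrow> 'm::ab_group_add \<Rightarrow> 'm"
    and m :: "'m \<Rightarrow> 'm \<Rightarrow> 'm"
    and \<Phi> :: "'f set" and \<eta> :: 'f and a b :: 'm
    and X :: "('f, 'm) axial"
  assumes char: "CHAR('f) \<noteq> 2"
    and Phi: "\<Phi> \<subseteq> {0, 1}"
    and eta: "\<eta> \<notin> {0, 1}"
    and alg: "comm_algebra scale m"
    and gen: "comm_algebra.two_generated scale m \<Phi> \<eta> a b"
    and X: "X = (type_alg scale m, {a, b})"
  shows "(\<Phi> \<noteq> {0, 1} \<and> \<eta> \<noteq> 1 / 2 \<and> \<eta> \<noteq> -1 \<longrightarrow> isomorphic_to_one_of_ten X \<eta>) \<and>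
    (\<Phi> \<noteq> {0, 1} \<and> \<eta> \<noteq> 1 / 2 \<and> \<eta> = -1 \<longrightarrow>
       isomorphic_to_one_of_ten X (-1) \<or>
       X \<cong> ax_3C_cross \<or> X \<cong> ax_hat_3C_cross \<or>
       X \<cong> ax_3C0_cross \<or> X \<cong> ax_3C00_cross \<or>
       X \<cong> ax_hat_3C0_cross \<or> X \<cong> ax_hat_3C00_cross)"
proof -
  interpret comm_algebra scale m by (rule alg)
  have axes: "axis \<Phi> \<eta> a" "axis \<Phi> \<eta> b" and generates: "subalgebra hull {a, b} = UNIV"
    using gen by (simp_all add: two_generated_def)
  then have nonzero: "a \<noteq> 0" "b \<noteq> 0" by (simp_all add: axis_def)
  have two: "(2::'f) \<noteq> 0" using char by (rule two_neq_0_if_CHAR_neq_2)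
  have "isomorphic_to_one_of_ten X \<eta> \<or> \<eta> = - 1 \<and> isomorphic_to_one_of_six_quotients X"
    if \<Phi>: "\<Phi> \<noteq> {0, 1}" and half: "\<eta> \<noteq> 1 / 2"
  proof -
    have \<eta>: "\<eta> \<noteq> 0" "\<eta> \<noteq> 1" "2 * \<eta> \<noteq> 1" using eta half two by (auto simp: field_simps)
    obtain A q s0 s1 where ab: "a = A 0 + s0" "b = A 1 + s1"
      and "hat_3C_relations scale m \<eta> A q s0 s1"
      by (rule hat_3C_relations_if_axes[OF axes Phi \<Phi> two \<eta>]) (rule that)
    then show ?thesis
      using hat_3C_relations.classification_if_generates generates nonzero unfolding X ab by blast
  qed
  then show ?thesis unfolding isomorphic_to_one_of_six_quotients_def by metis
qed

end
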